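(* Let $P$ be a projection algebra, let $S$ be any projection-generated regular $*$-semigroup with $P=\mathsf P(S)$, and let $p_0\in P$ be arbitrary. Let $D$ be the $\mathscr D$-class of $S$ containing $p_0$, let $P_D=P\cap D$, let $E_D$ be the set of idempotents of $S$ lying in $D$, and let $T$ be any $p_0$-rooted directed spanning tree for $\mathscr F_D$, identified with the set of idempotents $\{pq : (p,q)\text{ an edge of }T\}\subseteq E_D$. Then the maximal subgroup of $\mathsf{PG}(P)$ containing $x_{p_0}$ is defined by the group presentation with generators $\{a_e : e\in E_D\}$ and relations \begin{align*} &a_e=1 && \text{for all } e\in T\cup P_D,\\ &a_e=a_{e^*}^{-1} && \text{for all } e\in E_D,\\ &a_e^{-1}a_f=a_g^{-1}a_h && \text{for all linked squares } \begin{pmatrix} e & f \\ g & h \end{pmatrix} \text{ of idempotents in } D. \end{align*}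
   Context: A regular $*$-semigroup is a semigroup $S$ with a unary operation $a\mapsto a^*$ satisfying $(a^* )^*=a=aa^*a$ and $(ab)^*=b^*a^*$. A projection is an element $p$ with $p^2=p=p^*$; $\mathsf P(S)$ is the set of projections, and for $p,q\in \mathsf P(S)$ one has $pqp\in \mathsf P(S)$. The set $P=\mathsf P(S)$ with the unary operations $q\mapsto pqp$ ($p\in P$) is the projection algebra of $S$; every (abstract) projection algebra is of this form. $S$ is projection-generated if it is generated as a semigroup by $\mathsf P(S)$. $\mathsf{PG}(P)$ is the semigroup defined by the semigroup presentation with generators $x_p$ ($p\in P$) and relations $x_p^2=x_p$, $(x_px_q)^2=x_px_q$, $x_px_qx_p=x_{pqp}$ ($p,q\in P$). The maximal subgroup containing the idempotent $x_{p_0}$ is its $\mathscr H$-class in $\mathsf{PG}(P)$. The friendliness relation is $\mathscr F=\{(p,q)\in P\times P: pqp=p,\ qpq=q\}$, and $\mathscr F_D=\mathscr F\cap(P_D\times P_D)$, regarded as a symmetric (strongly connected) digraph on $P_D$; the map $(p,q)\mapsto pq$ is a bijection $\mathscr F_D\to E_D$ with inverse $e\mapsto(ee^*,e^*e)$. A $p_0$-rooted directed spanning tree of $\mathscr F_D$ is a subgraph on all of $P_D$ whose underlying undirected graph is a tree and in which there is a directed path from $p_0$ to every other vertex. A square of idempotents is an array $\begin{pmatrix} e & f \\ g & h \end{pmatrix}$ of (not necessarily distinct) idempotents with $e\,\mathscr R\,f$, $g\,\mathscr R\,h$, $e\,\mathscr L\,g$, $f\,\mathscr L\,h$. It is a linked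 square if there is a projection $p\in P$ with $pee^*p=e^*e$ and $phh^*p=h^*h$. *)

theory Defs
  imports "HOL-Algebra.Group" "Graph_Theory.Digraph_Component"
begin

section \<open>Semigroups and Green's relations\<close>

record 'a semigrp = "'a partial_object" +
  sgmult :: "'a \<Rightarrow> 'a \<Rightarrow> 'a" (infixl \<open>\<cdot>\<index>\<close> 70)

text \<open>The principal one-sided ideals \<open>a S\<^sup>1\<close> and \<open>S\<^sup>1 a\<close>.\<close>

definition right_ideal :: "('a, 'm) semigrp_scheme \<Rightarrow> 'a \<Rightarrow> 'a set" where
  "right_ideal S a = insert a {a \<cdot>\<^bsub>S\<^esub> s | s. s \<in> carrier S}"

definition left_ideal :: "('a, 'm) semigrp_scheme \<Rightarrow> 'a \<Rightarrow> 'a set" where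
  "left_ideal S a = insert a {s \<cdot>\<^bsub>S\<^esub> a | s. s \<in> carrier S}"

definition green_R :: "('a, 'm) semigrp_scheme \<Rightarrow> 'a rel" where
  "green_R S = {(a, b). a \<in> carrier S \<and> b \<in> carrier S \<and> right_ideal S a = right_ideal S b}"

definition green_L :: "('a, 'm) semigrp_scheme \<Rightarrow> 'a rel" where
  "green_L S = {(a, b). a \<in> carrier S \<and> b \<in> carrier S \<and> left_ideal S a = left_ideal S b}"

definition green_H :: "('a, 'm) semigrp_scheme \<Rightarrow> 'a rel" where
  "green_H S = green_R S \<inter> green_L S"

text \<open>
  The join of the equivalences \<open>\<R>\<close> and \<open>\<L>\<close> on the carrier: as both are reflexive and
  symmetric there, the transitive closure of the union is already an equivalence.
\<close>

definition green_D :: "('a, 'm) semigrp_scheme \<Rightarrow> 'a rel" where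
  "green_D S = (green_R S \<union> green_L S)\<^sup>+"

definition idempotents :: "('a, 'm) semigrp_scheme \<Rightarrow> 'a set" where
  "idempotents S = {e \<in> carrier S. e \<cdot>\<^bsub>S\<^esub> e = e}"

text \<open>The \<open>\<H>\<close>-class of \<open>e\<close>; this is a group when \<open>e\<close> is an idempotent of a semigroup.\<close>

definition maximal_subgroup :: "('a, 'm) semigrp_scheme \<Rightarrow> 'a \<Rightarrow> 'a monoid" where
  "maximal_subgroup S e = \<lparr>carrier = green_H S `` {e}, monoid.mult = (\<cdot>\<^bsub>S\<^esub>), one = e\<rparr>"

inductive_set subsemigroup_generated :: "('a, 'm) semigrp_scheme \<Rightarrow> 'a set \<Rightarrow> 'a set"
  for S :: "('a, 'm) semigrp_scheme" and A :: "'a set" where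
  gen: "a \<in> A \<Longrightarrow> a \<in> subsemigroup_generated S A"
| prod: "a \<in> subsemigroup_generated S A \<Longrightarrow> b \<in> subsemigroup_generated S A
    \<Longrightarrow> a \<cdot>\<^bsub>S\<^esub> b \<in> subsemigroup_generated S A"


section \<open>Regular *-semigroups\<close>

record 'a star_semigrp = "'a semigrp" +
  star :: "'a \<Rightarrow> 'a" (\<open>_\<^sup>\<star>\<index>\<close> [1000] 999)

locale regular_star_semigroup =
  fixes S :: "('a, 'm) star_semigrp_scheme" (structure)
  assumes mult_closed: "\<lbrakk>a \<in> carrier S; b \<in> carrier S\<rbrakk> \<Longrightarrow> a \<cdot> b \<in> carrier S"
    and mult_assoc: "\<lbrakk>a \<in> carrier S; b \<in> carrier S; c \<in> carrier S\<rbrakk>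
      \<Longrightarrow> (a \<cdot> b) \<cdot> c = a \<cdot> (b \<cdot> c)"
    and star_closed: "a \<in> carrier S \<Longrightarrow> a\<^sup>\<star> \<in> carrier S"
    and star_star: "a \<in> carrier S \<Longrightarrow> (a\<^sup>\<star>)\<^sup>\<star> = a"
    and mult_star_mult: "a \<in> carrier S \<Longrightarrow> a \<cdot> a\<^sup>\<star> \<cdot> a = a"
    and star_mult: "\<lbrakk>a \<in> carrier S; b \<in> carrier S\<rbrakk> \<Longrightarrow> (a \<cdot> b)\<^sup>\<star> = b\<^sup>\<star> \<cdot> a\<^sup>\<star>"

definition projections :: "('a, 'm) star_semigrp_scheme \<Rightarrow> 'a set" where
  "projections S = {p \<in> carrier S. p \<cdot>\<^bsub>S\<^esub> p = p \<and> p\<^sup>\<star>\<^bsub>S\<^esub> = p}"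

definition projection_generated :: "('a, 'm) star_semigrp_scheme \<Rightarrow> bool" where
  "projection_generated S \<longleftrightarrow> carrier S = subsemigroup_generated S (projections S)"

definition friendliness :: "('a, 'm) star_semigrp_scheme \<Rightarrow> 'a rel" where
  "friendliness S = {(p, q). p \<in> projections S \<and> q \<in> projections S
     \<and> p \<cdot>\<^bsub>S\<^esub> q \<cdot>\<^bsub>S\<^esub> p = p \<and> q \<cdot>\<^bsub>S\<^esub> p \<cdot>\<^bsub>S\<^esub> q = q}"

definition friendliness_digraph :: "('a, 'm) star_semigrp_scheme \<Rightarrow> 'a set \<Rightarrow> 'a pair_pre_digraph"
  where "friendliness_digraph S D =
    \<lparr>pverts = projections S \<inter> D,
     parcs = friendliness S \<inter> ((projections S \<inter> D) \<times> (projections S \<inter> D))\<rparr>"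

definition square :: "('a, 'm) star_semigrp_scheme \<Rightarrow> 'a \<Rightarrow> 'a \<Rightarrow> 'a \<Rightarrow> 'a \<Rightarrow> bool" where
  "square S e f g h \<longleftrightarrow>
     e \<in> idempotents S \<and> f \<in> idempotents S \<and> g \<in> idempotents S \<and> h \<in> idempotents S \<and>
     (e, f) \<in> green_R S \<and> (g, h) \<in> green_R S \<and> (e, g) \<in> green_L S \<and> (f, h) \<in> green_L S"

definition linked_square :: "('a, 'm) star_semigrp_scheme \<Rightarrow> 'a \<Rightarrow> 'a \<Rightarrow> 'a \<Rightarrow> 'a \<Rightarrow> bool" where
  "linked_square S e f g h \<longleftrightarrow> square S e f g h \<and>
     (\<exists>p \<in> projections S.
        p \<cdot>\<^bsub>S\<^esub> e \<cdot>\<^bsub>S\<^esub> e\<^sup>\<star>\<^bsub>S\<^esub> \<cdot>\<^bsub>S\<^esub> p = e\<^sup>\<star>\<^bsub>S\<^esub> \<cdot>\<^bsub>S\<^esub> e \<and>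
        p \<cdot>\<^bsub>S\<^esub> h \<cdot>\<^bsub>S\<^esub> h\<^sup>\<star>\<^bsub>S\<^esub> \<cdot>\<^bsub>S\<^esub> p = h\<^sup>\<star>\<^bsub>S\<^esub> \<cdot>\<^bsub>S\<^esub> h)"


section \<open>Rooted directed spanning trees\<close>

text \<open>
  The library predicate \<^const>\<open>tree\<close> only excludes directed cycles, so it does not say that the
  underlying undirected graph is a tree.  The latter is expressed on the symmetric closure, where
  every undirected edge \<open>{u, v}\<close> yields the closed walk \<open>u, v, u\<close> of length 2; cycles of any other
  length (loops have length 1) are cycles of the undirected graph, and vice versa.
\<close>

definition undirected_tree :: "'a pair_pre_digraph \<Rightarrow> bool" where
  "undirected_tree T \<longleftrightarrow> connected (with_proj T) \<and>
     (\<forall>c. pre_digraph.cycle (with_proj (mk_symmetric (with_proj T))) c \<longrightarrow> length c = 2)"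

definition rooted_spanning_tree :: "'a \<Rightarrow> 'a pair_pre_digraph \<Rightarrow> 'a pair_pre_digraph \<Rightarrow> bool" where
  "rooted_spanning_tree r T G \<longleftrightarrow>
     spanning (with_proj T) (with_proj G) \<and> undirected_tree T \<and>
     (\<forall>v \<in> pverts T. r \<rightarrow>\<^sup>*\<^bsub>with_proj T\<^esub> v)"


section \<open>Presentations\<close>

text \<open>The congruence generated by \<open>R\<close> on a set \<open>W\<close> of words closed under concatenation.\<close>

inductive_set word_cong :: "'x list set \<Rightarrow> 'x list rel \<Rightarrow> 'x list rel"
  for W :: "'x list set" and R :: "'x list rel" where
  rel: "(u, v) \<in> R \<Longrightarrow> u \<in> W \<Longrightarrow> v \<in> W \<Longrightarrow> (u, v) \<in> word_cong W R"
| refl: "u \<in> W \<Longrightarrow> (u, u) \<in> word_cong W R"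
| sym: "(u, v) \<in> word_cong W R \<Longrightarrow> (v, u) \<in> word_cong W R"
| trans: "(u, v) \<in> word_cong W R \<Longrightarrow> (v, w) \<in> word_cong W R \<Longrightarrow> (u, w) \<in> word_cong W R"
| append: "(u, v) \<in> word_cong W R \<Longrightarrow> (u', v') \<in> word_cong W R
    \<Longrightarrow> (u @ u', v @ v') \<in> word_cong W R"

text \<open>For classes \<open>A\<close>, \<open>B\<close> of a congruence \<open>C\<close> this is the class of \<open>u @ v\<close> (\<open>u \<in> A\<close>, \<open>v \<in> B\<close>).\<close>

definition class_mult :: "'x list rel \<Rightarrow> 'x list set \<Rightarrow> 'x list set \<Rightarrow> 'x list set" where
  "class_mult C A B = C `` {u @ v | u v. u \<in> A \<and> v \<in> B}"

definition semigroup_presentation :: "'x set \<Rightarrow> 'x list rel \<Rightarrow> 'x list set semigrp" where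
  "semigroup_presentation X R =
     (let W = lists X - {[]}; C = word_cong W R
      in \<lparr>carrier = W // C, sgmult = class_mult C\<rparr>)"

definition semigroup_generator :: "'x set \<Rightarrow> 'x list rel \<Rightarrow> 'x \<Rightarrow> 'x list set" where
  "semigroup_generator X R x = word_cong (lists X - {[]}) R `` {[x]}"

text \<open>
  Group words on \<open>X\<close> are lists over \<open>X \<times> bool\<close>, where \<open>(x, True)\<close> stands for \<open>x\<close> and
  \<open>(x, False)\<close> for \<open>x\<inverse>\<close>; a relation \<open>u = v\<close> is the pair \<open>(u, v)\<close>.
\<close>

definition free_cancellation :: "'x set \<Rightarrow> ('x \<times> bool) list rel" where
  "free_cancellation X = {([(x, b), (x, \<not> b)], []) | x b. x \<in> X}"

definition group_presentation ::
    "'x set \<Rightarrow> ('x \<times> bool) list rel \<Rightarrow> ('x \<times> bool) list set monoid" where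
  "group_presentation X R =
     (let W = lists (X \<times> UNIV); C = word_cong W (R \<union> free_cancellation X)
      in \<lparr>carrier = W // C, monoid.mult = class_mult C, one = C `` {[]}\<rparr>)"

lemma word_cong_subset:
  assumes "\<And>u v. u \<in> W \<Longrightarrow> v \<in> W \<Longrightarrow> u @ v \<in> W"
  shows "word_cong W R \<subseteq> W \<times> W"
proof (rule subrelI)
  fix u v assume "(u, v) \<in> word_cong W R"
  then show "(u, v) \<in> W \<times> W"
    by induction (auto intro: assms)
qed

lemma equiv_word_cong:
  assumes "\<And>u v. u \<in> W \<Longrightarrow> v \<in> W \<Longrightarrow> u @ v \<in> W"
  shows "equiv W (word_cong W R)"
proof (rule equivI)
  show "word_cong W R \<subseteq> W \<times> W" by (rule word_cong_subset[OF assms])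
qed (auto simp: refl_on_def intro!: symI transI
      intro: word_cong.refl word_cong.sym word_cong.trans)

lemma class_mult_classes:
  assumes W: "\<And>u v. u \<in> W \<Longrightarrow> v \<in> W \<Longrightarrow> u @ v \<in> W" and "u \<in> W" "v \<in> W"
  shows "class_mult (word_cong W R) (word_cong W R `` {u}) (word_cong W R `` {v}) =
    word_cong W R `` {u @ v}"
  using assms(2,3) unfolding class_mult_def
  by (auto intro: word_cong.refl) (meson word_cong.append word_cong.trans)

lemma group_group_presentation: "group (group_presentation X R)"
proof -
  define W where "W = lists (X \<times> (UNIV :: bool set))"
  define C where "C = word_cong W (R \<union> free_cancellation X)"
  define inv_word :: "('a \<times> bool) list \<Rightarrow> ('a \<times> bool) list"
    where "inv_word u = rev (map (\<lambda>(x, b). (x, \<not> b)) u)" for u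
  have W: "u @ v \<in> W" if "u \<in> W" "v \<in> W" for u v
    using that by (auto simp: W_def)
  have car: "A \<in> W // C \<longleftrightarrow> (\<exists>u \<in> W. A = C `` {u})" for A
    by (auto simp: quotient_def)
  have cm: "class_mult C (C `` {u}) (C `` {v}) = C `` {u @ v}" if "u \<in> W" "v \<in> W" for u v
    unfolding C_def by (rule class_mult_classes) (use W that in auto)
  have eq: "C `` {u} = C `` {v}" if "(u, v) \<in> C" for u v
    using that equiv_class_eq[OF equiv_word_cong[of W]] W unfolding C_def by blast
  have nil: "[] \<in> W" by (simp add: W_def)
  have inv: "inv_word u \<in> W \<and> (inv_word u @ u, []) \<in> C" if "u \<in> W" for u
    using that
  proof (induction u)
    case Nil
    then show ?case using nil by (auto simp: inv_word_def C_def intro: word_cong.refl)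
  next
    case (Cons a u)
    obtain x b where a: "a = (x, b)" by force
    have x: "x \<in> X" and u: "u \<in> W" using Cons.prems by (auto simp: a W_def)
    have iw: "inv_word (a # u) = inv_word u @ [(x, \<not> b)]" by (simp add: inv_word_def a)
    have w: "inv_word u \<in> W" and IH: "(inv_word u @ u, []) \<in> C" using Cons.IH[OF u] by auto
    have "([(x, \<not> b), (x, b)], []) \<in> C"
      unfolding C_def using x nil
      by (intro word_cong.rel) (auto simp: free_cancellation_def W_def)
    then have "([(x, \<not> b), (x, b)] @ u, [] @ u) \<in> C"
      unfolding C_def using u by (intro word_cong.append word_cong.refl)
    then have "(inv_word u @ [(x, \<not> b), (x, b)] @ u, inv_word u @ [] @ u) \<in> C"
      unfolding C_def by (rule word_cong.append[OF word_cong.refl[OF w]])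
    then have "(inv_word (a # u) @ a # u, []) \<in> C"
      using IH unfolding C_def iw by (auto simp: a intro: word_cong.trans)
    moreover have "inv_word (a # u) \<in> W" using w x by (auto simp: iw W_def)
    ultimately show ?case by blast
  qed
  have gp: "group_presentation X R = \<lparr>carrier = W // C, monoid.mult = class_mult C, one = C `` {[]}\<rparr>"
    by (simp add: group_presentation_def W_def C_def Let_def)
  show ?thesis
    unfolding gp
  proof (rule groupI; simp only: monoid.simps partial_object.simps)
    fix A assume "A \<in> W // C"
    then obtain u where u: "u \<in> W" "A = C `` {u}" by (auto simp: car)
    have "C `` {inv_word u} \<in> W // C" using inv[OF u(1)] by (auto simp: car)
    moreover have "class_mult C (C `` {inv_word u}) A = C `` {[]}"
      using inv[OF u(1)] u by (simp add: cm eq)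
    ultimately show "\<exists>B \<in> W // C. class_mult C B A = C `` {[]}" by blast
  qed (use nil W in \<open>auto simp: car cm\<close>)
qed


section \<open>Projection algebras and \<open>PG(P)\<close>\<close>

text \<open>
  A projection algebra is given by its set \<open>P\<close> and its unary operations
  \<open>\<theta> p = (\<lambda>q. pqp)\<close>, \<open>p \<in> P\<close>.  The letter \<open>p\<close> plays the role of the generator \<open>x\<^sub>p\<close>.
\<close>

definition pg_relations :: "'a set \<Rightarrow> ('a \<Rightarrow> 'a \<Rightarrow> 'a) \<Rightarrow> 'a list rel" where
  "pg_relations P \<theta> =
     {([p, p], [p]) | p. p \<in> P} \<union>
     {([p, q, p, q], [p, q]) | p q. p \<in> P \<and> q \<in> P} \<union>
     {([p, q, p], [\<theta> p q]) | p q. p \<in> P \<and> q \<in> P}"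

definition PG :: "'a set \<Rightarrow> ('a \<Rightarrow> 'a \<Rightarrow> 'a) \<Rightarrow> 'a list set semigrp" where
  "PG P \<theta> = semigroup_presentation P (pg_relations P \<theta>)"

definition pg_generator :: "'a set \<Rightarrow> ('a \<Rightarrow> 'a \<Rightarrow> 'a) \<Rightarrow> 'a \<Rightarrow> 'a list set" where
  "pg_generator P \<theta> p = semigroup_generator P (pg_relations P \<theta>) p"


section \<open>The relations for the maximal subgroup\<close>

definition tree_idempotents :: "('a, 'm) semigrp_scheme \<Rightarrow> 'a pair_pre_digraph \<Rightarrow> 'a set" where
  "tree_idempotents S T = {p \<cdot>\<^bsub>S\<^esub> q | p q. (p, q) \<in> parcs T}"

definition subgroup_relations ::
    "('a, 'm) star_semigrp_scheme \<Rightarrow> 'a set \<Rightarrow> 'a pair_pre_digraph \<Rightarrow> ('a \<times> bool) list rel" where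
  "subgroup_relations S D T =
     {([(e, True)], []) | e. e \<in> tree_idempotents S T \<union> (projections S \<inter> D)} \<union>
     {([(e, True)], [(e\<^sup>\<star>\<^bsub>S\<^esub>, False)]) | e. e \<in> idempotents S \<inter> D} \<union>
     {([(e, False), (f, True)], [(g, False), (h, True)]) | e f g h.
        linked_square S e f g h \<and> e \<in> D \<and> f \<in> D \<and> g \<in> D \<and> h \<in> D}"

end

theory Submission
  imports Defs
begin

text \<open>
  Write \<open>a\<^bsub>pq\<^esub>\<close> for the generator of the presented group \<open>G\<close> belonging to a friendly pair \<open>(p, q)\<close>
  in \<open>D\<close>, and fix for each \<open>p\<close> in \<open>P\<^sub>D\<close> a walk in the tree from \<open>p\<^sub>0\<close> to \<open>p\<close> and one back.  The word
  formed by the walk to \<open>p\<close>, then \<open>x\<^sub>p x\<^sub>q\<close>, then the walk back from \<open>q\<close> represents an element of the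
  maximal subgroup of \<open>PG(P)\<close>.  Closed walks in the tree collapse to a point, so these words satisfy
  the defining relations of \<open>G\<close>.  They generate because \<open>x\<^sub>p x\<^sub>r = x\<^sub>p x\<^bsub>rpr\<^esub>\<close>, so that any word
  acting nontrivially on \<open>p\<^sub>0\<close> can be traced along friendly pairs.  For injectivity, \<open>PG(P)\<close> acts
  by partial maps on \<open>P\<^sub>D \<times> G\<close>: a projection \<open>r\<close> sends \<open>(p, g)\<close> to \<open>(rpr, g a\<^bsub>pr\<^esub>)\<close> if \<open>prp = p\<close>.
  The relations of linked squares are exactly what makes this respect \<open>x\<^sub>q x\<^sub>r x\<^sub>q = x\<^bsub>qrq\<^esub>\<close>, and the
  word of a group element \<open>g\<close> moves \<open>(p\<^sub>0, 1)\<close> to \<open>(p\<^sub>0, g)\<close>.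
\<close>

section \<open>Presentations\<close>

lemma lists_append_closed: "u \<in> lists X \<Longrightarrow> v \<in> lists X \<Longrightarrow> u @ v \<in> lists X"
  by simp

lemma nonempty_lists_append_closed:
  "u \<in> lists X - {[]} \<Longrightarrow> v \<in> lists X - {[]} \<Longrightarrow> u @ v \<in> lists X - {[]}"
  by auto

lemma word_cong_class_eq_iff:
  assumes "\<And>u v. u \<in> W \<Longrightarrow> v \<in> W \<Longrightarrow> u @ v \<in> W" and "u \<in> W" "v \<in> W"
  shows "word_cong W R `` {u} = word_cong W R `` {v} \<longleftrightarrow> (u, v) \<in> word_cong W R"
  using eq_equiv_class_iff[OF equiv_word_cong[of W R]] assms by blast

abbreviation group_word_cong :: "'x set \<Rightarrow> ('x \<times> bool) list rel \<Rightarrow> ('x \<times> bool) list rel" where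
  "group_word_cong X R \<equiv> word_cong (lists (X \<times> UNIV)) (R \<union> free_cancellation X)"

lemma carrier_group_presentation:
  "carrier (group_presentation X R) = (\<lambda>w. group_word_cong X R `` {w}) ` lists (X \<times> UNIV)"
  by (auto simp: group_presentation_def Let_def quotient_def)

lemma mult_group_presentation:
  assumes "u \<in> lists (X \<times> UNIV)" "v \<in> lists (X \<times> UNIV)"
  shows "group_word_cong X R `` {u} \<otimes>\<^bsub>group_presentation X R\<^esub> group_word_cong X R `` {v}
    = group_word_cong X R `` {u @ v}"
  unfolding group_presentation_def Let_def monoid.simps
  by (rule class_mult_classes) (use assms in auto)

lemma one_group_presentation:
  "\<one>\<^bsub>group_presentation X R\<^esub> = group_word_cong X R `` {[]}"
  by (simp add: group_presentation_def Let_def)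

lemma group_presentation_eq_iff:
  assumes "u \<in> lists (X \<times> UNIV)" "v \<in> lists (X \<times> UNIV)"
  shows "group_word_cong X R `` {u} = group_word_cong X R `` {v} \<longleftrightarrow> (u, v) \<in> group_word_cong X R"
  by (rule word_cong_class_eq_iff) (use assms in auto)

definition presentation_generator :: "'x set \<Rightarrow> ('x \<times> bool) list rel \<Rightarrow> 'x \<Rightarrow> ('x \<times> bool) list set"
  where "presentation_generator X R x = group_word_cong X R `` {[(x, True)]}"

lemma presentation_generator_closed:
  "x \<in> X \<Longrightarrow> presentation_generator X R x \<in> carrier (group_presentation X R)"
  by (auto simp: presentation_generator_def carrier_group_presentation)

lemma inv_presentation_generator:
  assumes "x \<in> X"
  shows "inv\<^bsub>group_presentation X R\<^esub> presentation_generator X R x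
    = group_word_cong X R `` {[(x, False)]}"
proof -
  interpret group "group_presentation X R" by (rule group_group_presentation)
  have "([(x, False), (x, True)], []) \<in> free_cancellation X"
    using assms by (force simp: free_cancellation_def)
  then have "([(x, False), (x, True)], []) \<in> group_word_cong X R"
    using assms by (intro word_cong.rel) auto
  then have "group_word_cong X R `` {[(x, False)]} \<otimes>\<^bsub>group_presentation X R\<^esub>
      presentation_generator X R x = \<one>\<^bsub>group_presentation X R\<^esub>"
    using assms
    by (simp add: presentation_generator_def mult_group_presentation one_group_presentation
        group_presentation_eq_iff)
  then show ?thesis
    using assms
    by (intro inv_equality) (auto simp: carrier_group_presentation presentation_generator_def)
qed

lemma carrier_semigroup_presentation:
  "carrier (semigroup_presentation X R) = (\<lambda>w. word_cong (lists X - {[]}) R `` {w}) ` (lists X - {[]})"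
  by (auto simp: semigroup_presentation_def Let_def quotient_def)

lemma mult_semigroup_presentation:
  assumes "u \<in> lists X - {[]}" "v \<in> lists X - {[]}"
  shows "word_cong (lists X - {[]}) R `` {u} \<cdot>\<^bsub>semigroup_presentation X R\<^esub>
      word_cong (lists X - {[]}) R `` {v} = word_cong (lists X - {[]}) R `` {u @ v}"
  unfolding semigroup_presentation_def Let_def semigrp.simps
  by (rule class_mult_classes[OF nonempty_lists_append_closed]) (use assms in auto)


section \<open>Green's relations\<close>

locale semigroup_carrier =
  fixes S :: "('a, 'm) semigrp_scheme" (structure)
  assumes closed: "\<lbrakk>a \<in> carrier S; b \<in> carrier S\<rbrakk> \<Longrightarrow> a \<cdot> b \<in> carrier S"
    and assoc: "\<lbrakk>a \<in> carrier S; b \<in> carrier S; c \<in> carrier S\<rbrakk> \<Longrightarrow> (a \<cdot> b) \<cdot> c = a \<cdot> (b \<cdot> c)"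
begin

lemma right_ideal_subset:
  assumes "b \<in> carrier S" "x \<in> carrier S"
  shows "right_ideal S (b \<cdot> x) \<subseteq> right_ideal S b"
proof
  fix z assume "z \<in> right_ideal S (b \<cdot> x)"
  then consider "z = b \<cdot> x" | s where "s \<in> carrier S" "z = b \<cdot> x \<cdot> s"
    by (auto simp: right_ideal_def)
  then show "z \<in> right_ideal S b"
    using assms by cases (force simp: right_ideal_def assoc intro: closed)+
qed

lemma left_ideal_subset:
  assumes "b \<in> carrier S" "x \<in> carrier S"
  shows "left_ideal S (x \<cdot> b) \<subseteq> left_ideal S b"
proof
  fix z assume "z \<in> left_ideal S (x \<cdot> b)"
  then consider "z = x \<cdot> b" | s where "s \<in> carrier S" "z = s \<cdot> (x \<cdot> b)"
    by (auto simp: left_ideal_def)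
  then show "z \<in> left_ideal S b"
    using assms by cases (force simp: left_ideal_def assoc[symmetric] intro: closed)+
qed

lemma green_RI:
  assumes "a \<in> carrier S" "b \<in> carrier S" "x \<in> carrier S" "y \<in> carrier S"
    and "a = b \<cdot> x" "b = a \<cdot> y"
  shows "(a, b) \<in> green_R S"
  using right_ideal_subset[OF assms(2,3)] right_ideal_subset[OF assms(1,4)] assms(1,2)
  unfolding assms(5)[symmetric] assms(6)[symmetric] by (simp add: green_R_def)

lemma green_LI:
  assumes "a \<in> carrier S" "b \<in> carrier S" "x \<in> carrier S" "y \<in> carrier S"
    and "a = x \<cdot> b" "b = y \<cdot> a"
  shows "(a, b) \<in> green_L S"
  using left_ideal_subset[OF assms(2,3)] left_ideal_subset[OF assms(1,4)] assms(1,2)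
  unfolding assms(5)[symmetric] assms(6)[symmetric] by (simp add: green_L_def)

end

lemma green_RD:
  assumes "(a, b) \<in> green_R S"
  shows "a = b \<or> (\<exists>x \<in> carrier S. a = b \<cdot>\<^bsub>S\<^esub> x)"
  using assms by (auto simp: green_R_def right_ideal_def)

lemma green_LD:
  assumes "(a, b) \<in> green_L S"
  shows "a = b \<or> (\<exists>x \<in> carrier S. a = x \<cdot>\<^bsub>S\<^esub> b)"
  using assms by (auto simp: green_L_def left_ideal_def)

lemma green_sym:
  "(a, b) \<in> green_R S \<Longrightarrow> (b, a) \<in> green_R S" "(a, b) \<in> green_L S \<Longrightarrow> (b, a) \<in> green_L S"
  by (auto simp: green_R_def green_L_def)


section \<open>Regular *-semigroups\<close>

context regular_star_semigroup
begin

sublocale semigroup_carrier S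
  by unfold_locales (auto simp: mult_closed mult_assoc)

abbreviation P :: "'a set" where "P \<equiv> projections S"

lemma projD: "p \<in> P \<Longrightarrow> p \<in> carrier S" "p \<in> P \<Longrightarrow> p \<cdot> p = p" "p \<in> P \<Longrightarrow> p\<^sup>\<star> = p"
  by (auto simp: projections_def)

lemma proj_left_absorb: "p \<in> P \<Longrightarrow> a \<in> carrier S \<Longrightarrow> p \<cdot> (p \<cdot> a) = p \<cdot> a"
  by (simp add: mult_assoc[symmetric] projD)

lemmas sg_simps = mult_assoc mult_closed star_closed star_mult star_star projD proj_left_absorb

lemma star_mult_self_proj: "a \<in> carrier S \<Longrightarrow> a\<^sup>\<star> \<cdot> a \<in> P"
proof -
  assume a: "a \<in> carrier S"
  have "a\<^sup>\<star> \<cdot> (a \<cdot> (a\<^sup>\<star> \<cdot> a)) = a\<^sup>\<star> \<cdot> a"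
    using a mult_star_mult[OF a] by (simp add: mult_assoc mult_closed star_closed)
  then show ?thesis
    using a
    by (simp add: projections_def mult_assoc mult_closed star_closed star_mult star_star)
qed

lemma mult_star_self_proj: "a \<in> carrier S \<Longrightarrow> a \<cdot> a\<^sup>\<star> \<in> P"
  using star_mult_self_proj[of "a\<^sup>\<star>"] by (simp add: sg_simps)

text \<open>Regularity of \<open>p \<cdot> q\<close>, whose star is
  \<open>q \<cdot> p\<close>.\<close>

lemma proj_mult_idem:
  assumes "p \<in> P" "q \<in> P" shows "p \<cdot> (q \<cdot> (p \<cdot> q)) = p \<cdot> q"
  using mult_star_mult[of "p \<cdot> q"] assms by (simp add: sg_simps)

lemma proj_mult_idem':
  assumes "p \<in> P" "q \<in> P" "a \<in> carrier S" shows "p \<cdot> (q \<cdot> (p \<cdot> (q \<cdot> a))) = p \<cdot> (q \<cdot> a)"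
  using arg_cong[OF proj_mult_idem[OF assms(1,2)], of "\<lambda>x. x \<cdot> a"] assms by (simp add: sg_simps)

text \<open>With \<open>a = q \<cdot> p\<close> this is the projection
  \<open>a\<^sup>\<star> \<cdot> a\<close>.\<close>

lemma conj_proj: "p \<in> P \<Longrightarrow> q \<in> P \<Longrightarrow> p \<cdot> q \<cdot> p \<in> P"
  using star_mult_self_proj[of "q \<cdot> p"] by (simp add: sg_simps)

lemma proj_eq_of_absorb: "p \<in> P \<Longrightarrow> q \<in> P \<Longrightarrow> p \<cdot> q = p \<Longrightarrow> q \<cdot> p = q \<Longrightarrow> p = q"
  by (metis projD star_mult)

section \<open>Friendly pairs and their idempotents\<close>

lemma friendly_sym: "(p, q) \<in> friendliness S \<Longrightarrow> (q, p) \<in> friendliness S"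
  by (auto simp: friendliness_def)

lemma friendly_refl: "p \<in> P \<Longrightarrow> (p, p) \<in> friendliness S"
  by (auto simp: friendliness_def sg_simps)

lemma friendlyD:
  assumes "(p, q) \<in> friendliness S"
  shows "p \<in> P" "q \<in> P" "p \<cdot> q \<cdot> p = p" "q \<cdot> p \<cdot> q = q"
  using assms by (auto simp: friendliness_def)

text \<open>The condition \<open>p \<cdot> r \<cdot> p = p\<close> says that the letter
  \<open>r\<close> can act at \<open>p\<close>; the position then moves along this friendly
  pair.\<close>

lemma friendly_conj:
  assumes "p \<in> P" "r \<in> P" "p \<cdot> r \<cdot> p = p"
  shows "(p, r \<cdot> p \<cdot> r) \<in> friendliness S"
proof -
  have "p \<cdot> (r \<cdot> p) = p" using assms by (simp add: sg_simps)
  then show ?thesis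
    using assms conj_proj[of r p] proj_mult_idem'[of r p r]
    by (simp add: friendliness_def sg_simps)
qed

lemma mult_conj: "p \<in> P \<Longrightarrow> r \<in> P \<Longrightarrow> p \<cdot> (r \<cdot> p \<cdot> r) = p \<cdot> r"
  by (simp add: sg_simps proj_mult_idem)

text \<open>Converse of \<open>friendly_conj\<close>: the product
  \<open>p \<cdot> (r \<cdot> p \<cdot> r) \<cdot> p\<close> collapses to
  \<open>p \<cdot> r \<cdot> p\<close>.\<close>

lemma friendly_conj_absorb:
  assumes "p \<in> P" "(p, r \<cdot> p \<cdot> r) \<in> friendliness S" "r \<in> P"
  shows "p \<cdot> r \<cdot> p = p"
  using friendlyD(3)[OF assms(2)] assms by (simp add: sg_simps proj_mult_idem')

lemma green_R_friendly:
  assumes "(p, q) \<in> friendliness S" shows "(p, p \<cdot> q) \<in> green_R S"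
  using friendlyD[OF assms] by (intro green_RI[where x = p and y = q]) (auto intro: mult_closed projD)

lemma green_L_friendly:
  assumes "(p, q) \<in> friendliness S" shows "(p \<cdot> q, q) \<in> green_L S"
  using friendlyD[OF assms]
  by (intro green_LI[where x = p and y = q]) (auto simp: mult_assoc[symmetric] projD intro: mult_closed)

lemma friendly_mult_idem:
  assumes "(p, q) \<in> friendliness S" shows "p \<cdot> q \<in> idempotents S"
  using friendlyD(1,2)[OF assms] by (simp add: idempotents_def sg_simps proj_mult_idem)

lemma friendly_mult_star:
  assumes "(p, q) \<in> friendliness S"
  shows "(p \<cdot> q)\<^sup>\<star> = q \<cdot> p" "(p \<cdot> q) \<cdot> (p \<cdot> q)\<^sup>\<star> = p" "(p \<cdot> q)\<^sup>\<star> \<cdot> (p \<cdot> q) = q"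
  using friendlyD[OF assms] by (auto simp: sg_simps)

text \<open>Every idempotent comes from a friendly pair: as \<open>e\<^sup>\<star>\<close> is
  idempotent too, the product of the two projections shrinks to
  \<open>e \<cdot> e\<^sup>\<star> \<cdot> e = e\<close>.\<close>

lemma idempotent_friendly:
  assumes "e \<in> idempotents S"
  shows "(e \<cdot> e\<^sup>\<star>, e\<^sup>\<star> \<cdot> e) \<in> friendliness S" "(e \<cdot> e\<^sup>\<star>) \<cdot> (e\<^sup>\<star> \<cdot> e) = e"
proof -
  have e: "e \<in> carrier S" "e \<cdot> e = e" using assms by (auto simp: idempotents_def)
  note s = mult_assoc mult_closed star_closed
  have 1: "e\<^sup>\<star> \<cdot> e\<^sup>\<star> = e\<^sup>\<star>" using e by (metis star_mult)
  have 2: "e \<cdot> (e\<^sup>\<star> \<cdot> e) = e" using e mult_star_mult[of e] by (simp add: s)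
  have 3: "e\<^sup>\<star> \<cdot> (e \<cdot> e\<^sup>\<star>) = e\<^sup>\<star>" using e mult_star_mult[of "e\<^sup>\<star>"] by (simp add: s star_star)
  have l: "e \<cdot> (e \<cdot> x) = e \<cdot> x" "e\<^sup>\<star> \<cdot> (e\<^sup>\<star> \<cdot> x) = e\<^sup>\<star> \<cdot> x"
    "e \<cdot> (e\<^sup>\<star> \<cdot> (e \<cdot> x)) = e \<cdot> x" "e\<^sup>\<star> \<cdot> (e \<cdot> (e\<^sup>\<star> \<cdot> x)) = e\<^sup>\<star> \<cdot> x" if "x \<in> carrier S" for x
    using that e 1 mult_star_mult[OF e(1)] mult_star_mult[OF star_closed[OF e(1)]]
    by (simp_all add: mult_assoc[symmetric] mult_closed star_closed star_star)
  show "(e \<cdot> e\<^sup>\<star>, e\<^sup>\<star> \<cdot> e) \<in> friendliness S" "(e \<cdot> e\<^sup>\<star>) \<cdot> (e\<^sup>\<star> \<cdot> e) = e"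
    using e mult_star_self_proj[of e] star_mult_self_proj[of e]
    by (simp_all add: friendliness_def s l 1 2 3)
qed

text \<open>If \<open>e = f \<cdot> x\<close>, then \<open>f \<cdot> f\<^sup>\<star>\<close> fixes
  \<open>e\<close> on the left, hence also \<open>e \<cdot> e\<^sup>\<star>\<close>. By symmetry the
  two projections absorb each other, which forces equality.\<close>

lemma green_R_mult_star:
  assumes "(e, f) \<in> green_R S" shows "e \<cdot> e\<^sup>\<star> = f \<cdot> f\<^sup>\<star>"
proof -
  have absorb: "b \<cdot> b\<^sup>\<star> \<cdot> (a \<cdot> a\<^sup>\<star>) = a \<cdot> a\<^sup>\<star>" if "(a, b) \<in> green_R S" for a b
  proof -
    have c: "a \<in> carrier S" "b \<in> carrier S" using that by (auto simp: green_R_def)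
    have "b \<cdot> b\<^sup>\<star> \<cdot> a = a"
      using green_RD[OF that] c mult_star_mult[of b]
      by (auto simp: mult_assoc[symmetric] mult_closed star_closed)
    then show ?thesis using c by (metis mult_assoc mult_closed star_closed)
  qed
  have c: "e \<in> carrier S" "f \<in> carrier S" using assms by (auto simp: green_R_def)
  note P = mult_star_self_proj[OF c(1)] mult_star_self_proj[OF c(2)]
  show ?thesis
    using absorb[OF assms] absorb[OF green_sym(1)[OF assms]] proj_eq_of_absorb[OF P] projD(1,3)[OF P(1)]
      projD(1,3)[OF P(2)] by (metis star_mult)
qed

lemma green_L_star: "(e, f) \<in> green_L S \<Longrightarrow> (e\<^sup>\<star>, f\<^sup>\<star>) \<in> green_R S"
proof -
  assume *: "(e, f) \<in> green_L S"
  have c: "e \<in> carrier S" "f \<in> carrier S" using * by (auto simp: green_L_def)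
  have ex: "\<exists>x \<in> carrier S. a = x \<cdot> b" if "(a, b) \<in> green_L S" for a b
    using green_LD[OF that]
  proof
    assume "a = b"
    \<comment> \<open>The adjoined identity of \<open>left_ideal\<close> is replaced by
      \<open>b \<cdot> b\<^sup>\<star>\<close>, which fixes \<open>b\<close> on the left.\<close>
    then show ?thesis
      using that mult_star_mult[of b]
      by (intro bexI[of _ "b \<cdot> b\<^sup>\<star>"]) (auto simp: green_L_def intro: mult_closed star_closed)
  qed
  obtain x y where "x \<in> carrier S" "e = x \<cdot> f" "y \<in> carrier S" "f = y \<cdot> e"
    using ex[OF *] ex[OF green_sym(2)[OF *]] by blast
  then show ?thesis
    using c by (intro green_RI[where x = "x\<^sup>\<star>" and y = "y\<^sup>\<star>"]) (auto simp: star_closed, (metis star_mult)+)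
qed

lemma green_L_star_mult:
  assumes "(e, f) \<in> green_L S" shows "e\<^sup>\<star> \<cdot> e = f\<^sup>\<star> \<cdot> f"
  using green_R_mult_star[OF green_L_star[OF assms]] assms by (simp add: star_star green_L_def)

text \<open>The letters \<open>q\<close>, \<open>r\<close>, \<open>q\<close> move \<open>p\<close>
  to \<open>p1\<close>, \<open>p2\<close>, \<open>p3\<close>. Once the first two moves are possible,
  so is the third, a further \<open>r\<close> leads back to \<open>p2\<close>, and
  \<open>q \<cdot> r \<cdot> q\<close> moves \<open>p\<close> to \<open>p3\<close> at once. The key
  identity is \<open>main\<close>.\<close>

lemma two_steps:
  assumes P: "p \<in> P" "q \<in> P" "r \<in> P"
    and p1: "p \<cdot> q \<cdot> p = p" "p1 = q \<cdot> p \<cdot> q"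
    and p2: "p1 \<cdot> r \<cdot> p1 = p1" "p2 = r \<cdot> p1 \<cdot> r" and p3: "p3 = q \<cdot> p2 \<cdot> q"
  shows "p2 \<cdot> q \<cdot> p2 = p2" "r \<cdot> p3 \<cdot> r = p2" "p3 \<cdot> r \<cdot> p3 = p3"
    "p3 = (q \<cdot> r \<cdot> q) \<cdot> p \<cdot> (q \<cdot> r \<cdot> q)" "p \<cdot> (q \<cdot> r \<cdot> q) \<cdot> p = p"
proof -
  have p1P: "p1 \<in> P" and p2P: "p2 \<in> P" and p3P: "p3 \<in> P"
    using assms by (auto intro!: conj_proj)
  have pqp: "p \<cdot> (q \<cdot> p) = p" using p1(1) P by (simp add: sg_simps)
  have pqp': "p \<cdot> (q \<cdot> (p \<cdot> x)) = p \<cdot> x" if "x \<in> carrier S" for x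
    using p1(1) P that by (simp add: mult_assoc[symmetric] mult_closed projD)
  have "q \<cdot> (p \<cdot> (q \<cdot> (r \<cdot> (q \<cdot> (p \<cdot> q))))) = q \<cdot> (p \<cdot> q)"
    using p2(1) P by (simp add: p1(2) sg_simps)
  \<comment> \<open>Multiplying by \<open>p\<close> on both sides lets every
    \<open>p \<cdot> q \<cdot> p\<close> collapse to \<open>p\<close>.\<close>
  then have "p \<cdot> (q \<cdot> (p \<cdot> (q \<cdot> (r \<cdot> (q \<cdot> (p \<cdot> q)))))) \<cdot> p = p \<cdot> (q \<cdot> (p \<cdot> q)) \<cdot> p"
    by simp
  then have main: "p \<cdot> (q \<cdot> (r \<cdot> (q \<cdot> p))) = p"
    using P pqp by (simp add: sg_simps pqp')
  have main': "p \<cdot> (q \<cdot> (r \<cdot> (q \<cdot> (p \<cdot> x)))) = p \<cdot> x" if "x \<in> carrier S" for x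
    using arg_cong[OF main, of "\<lambda>y. y \<cdot> x"] P that by (simp add: sg_simps)
  show "p \<cdot> (q \<cdot> r \<cdot> q) \<cdot> p = p" using main P by (simp add: sg_simps)
  show "p3 = (q \<cdot> r \<cdot> q) \<cdot> p \<cdot> (q \<cdot> r \<cdot> q)"
    using P by (simp add: p1(2) p2(2) p3 sg_simps)
  show p2q: "p2 \<cdot> q \<cdot> p2 = p2"
    using P by (simp add: p1(2) p2(2) sg_simps proj_mult_idem' main')
  show rp3: "r \<cdot> p3 \<cdot> r = p2"
    using P by (simp add: p1(2) p2(2) p3 sg_simps proj_mult_idem proj_mult_idem')
  have "(p3, r \<cdot> p3 \<cdot> r) \<in> friendliness S"
    unfolding rp3 using friendly_sym[OF friendly_conj[OF p2P P(2) p2q]] unfolding p3 .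
  then show "p3 \<cdot> r \<cdot> p3 = p3" by (rule friendly_conj_absorb[OF p3P _ P(3)])
qed

text \<open>Converse direction to \<open>two_steps\<close>: if \<open>q \<cdot> r \<cdot> q\<close>
  can act at \<open>p\<close>, then \<open>q\<close> can act at \<open>p\<close> and
  \<open>r\<close> at the resulting projection. It handles the undefined cases of the
  action.\<close>

lemma conj_conj_absorb:
  assumes P: "p \<in> P" "q \<in> P" "r \<in> P" and "p \<cdot> (q \<cdot> r \<cdot> q) \<cdot> p = p"
  shows "p \<cdot> q \<cdot> p = p" "(q \<cdot> p \<cdot> q) \<cdot> r \<cdot> (q \<cdot> p \<cdot> q) = q \<cdot> p \<cdot> q"
proof -
  have main: "p \<cdot> (q \<cdot> (r \<cdot> (q \<cdot> p))) = p" using assms by (simp add: sg_simps)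
  have main': "p \<cdot> (q \<cdot> (r \<cdot> (q \<cdot> (p \<cdot> x)))) = p \<cdot> x" if "x \<in> carrier S" for x
    using arg_cong[OF main, of "\<lambda>y. y \<cdot> x"] P that by (simp add: sg_simps)
  have "p \<cdot> (q \<cdot> (p \<cdot> (q \<cdot> (r \<cdot> (q \<cdot> p))))) = p \<cdot> (q \<cdot> (r \<cdot> (q \<cdot> p)))"
    using P by (simp add: sg_simps proj_mult_idem')
  then show "p \<cdot> q \<cdot> p = p" using P unfolding main by (simp add: sg_simps)
  show "(q \<cdot> p \<cdot> q) \<cdot> r \<cdot> (q \<cdot> p \<cdot> q) = q \<cdot> p \<cdot> q" using P by (simp add: sg_simps main')
qed

end

section \<open>Words over the projections\<close>

locale projection_words = regular_star_semigroup S
  for S :: "('a, 'm) star_semigrp_scheme" (structure) +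
  fixes \<theta> :: "'a \<Rightarrow> 'a \<Rightarrow> 'a"
  assumes \<theta>: "\<And>p q. p \<in> P \<Longrightarrow> q \<in> P \<Longrightarrow> \<theta> p q = p \<cdot> q \<cdot> p"
begin

abbreviation pg_cong :: "'a list rel" where
  "pg_cong \<equiv> word_cong (lists P - {[]}) (pg_relations P \<theta>)"

definition pg_eq :: "'a list \<Rightarrow> 'a list \<Rightarrow> bool" (infix \<open>\<approx>\<close> 50) where
  "u \<approx> v \<longleftrightarrow> (u, v) \<in> pg_cong"

abbreviation pg_class :: "'a list \<Rightarrow> 'a list set" where
  "pg_class u \<equiv> pg_cong `` {u}"

lemma pg_eq_lists: "u \<approx> v \<Longrightarrow> u \<in> lists P - {[]} \<and> v \<in> lists P - {[]}"
  using word_cong_subset[of "lists P - {[]}" "pg_relations P \<theta>"] by (fastforce simp: pg_eq_def)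

lemma pg_refl: "u \<in> lists P \<Longrightarrow> u \<noteq> [] \<Longrightarrow> u \<approx> u"
  unfolding pg_eq_def by (rule word_cong.refl) auto

lemma pg_sym: "u \<approx> v \<Longrightarrow> v \<approx> u"
  unfolding pg_eq_def by (rule word_cong.sym)

lemma pg_trans [trans]: "u \<approx> v \<Longrightarrow> v \<approx> w \<Longrightarrow> u \<approx> w"
  unfolding pg_eq_def by (rule word_cong.trans)

lemma pg_append: "u \<approx> v \<Longrightarrow> u' \<approx> v' \<Longrightarrow> u @ u' \<approx> v @ v'"
  unfolding pg_eq_def by (rule word_cong.append)

lemma pg_rel: "(u, v) \<in> pg_relations P \<theta> \<Longrightarrow> u \<in> lists P - {[]} \<Longrightarrow> v \<in> lists P - {[]} \<Longrightarrow> u \<approx> v"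
  unfolding pg_eq_def by (rule word_cong.rel)

lemma pg_context:
  assumes "u \<approx> v" "x \<in> lists P" "y \<in> lists P"
  shows "x @ u @ y \<approx> x @ v @ y"
proof -
  have *: "u @ y \<approx> v @ y"
    by (cases "y = []") (use assms in \<open>auto intro: pg_append pg_refl\<close>)
  show ?thesis
    by (cases "x = []") (use assms * in \<open>auto intro: pg_append pg_refl\<close>)
qed

section \<open>Consequences of the defining relations of \<open>PG P \<theta>\<close>\<close>

lemma pg_idem: "p \<in> P \<Longrightarrow> [p, p] \<approx> [p]"
  by (rule pg_rel) (auto simp: pg_relations_def)

lemma pg_square: "p \<in> P \<Longrightarrow> q \<in> P \<Longrightarrow> [p, q, p, q] \<approx> [p, q]"
  by (rule pg_rel) (auto simp: pg_relations_def)

lemma pg_conj: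
  assumes "p \<in> P" "q \<in> P" shows "[p, q, p] \<approx> [p \<cdot> q \<cdot> p]"
  by (rule pg_rel) (use assms conj_proj[OF assms] in \<open>auto simp: pg_relations_def \<theta>\<close>)

lemma pg_friendly: "(p, q) \<in> friendliness S \<Longrightarrow> [p, q, p] \<approx> [p]"
  using pg_conj[of p q] friendlyD[of p q] by simp

text \<open>Doubling \<open>[p, r]\<close> by \<open>pg_square\<close> creates the factor
  \<open>[r, p, r]\<close>, which is a single letter. Thus a letter can be exchanged for the
  position it leads to.\<close>

lemma pg_mult_conj:
  assumes "p \<in> P" "r \<in> P" shows "[p, r] \<approx> [p, r \<cdot> p \<cdot> r]"
proof -
  have "[p, r] \<approx> [p] @ [r, p, r] @ []" using pg_sym[OF pg_square[OF assms]] by simp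
  also have "\<dots> \<approx> [p] @ [r \<cdot> p \<cdot> r] @ []" using assms by (intro pg_context pg_conj) auto
  finally show ?thesis by simp
qed

lemma pg_conj_mult:
  assumes "p \<in> P" "r \<in> P" shows "[r \<cdot> p \<cdot> r, p] \<approx> [r, p]"
proof -
  have "[r \<cdot> p \<cdot> r, p] \<approx> [] @ [r, p, r] @ [p]"
    using pg_context[OF pg_sym[OF pg_conj[OF assms(2,1)]], of "[]" "[p]"] assms by simp
  also have "[] @ [r, p, r] @ [p] \<approx> [r, p]" using pg_square[OF assms(2,1)] by simp
  finally show ?thesis .
qed

text \<open>The relation of \<open>PG(P)\<close> behind a linked square: both sides equal the word \<open>r u r v r\<close>.\<close>

lemma pg_linked:
  assumes "r \<in> P" "u \<in> P" "v \<in> P"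
  shows "[r \<cdot> u \<cdot> r, u, r \<cdot> v \<cdot> r] \<approx> [r \<cdot> u \<cdot> r, v, r \<cdot> v \<cdot> r]"
proof -
  let ?s = "r \<cdot> u \<cdot> r" and ?t = "r \<cdot> v \<cdot> r"
  have st: "?s \<in> P" "?t \<in> P" using assms by (auto intro: conj_proj)
  have "[?s, u] @ [?t] \<approx> [r, u] @ [r, v, r]"
    using assms by (intro pg_append pg_conj_mult pg_sym[OF pg_conj])
  also have "[r, u] @ [r, v, r] = [r, u, r] @ [v, r]" by simp
  also have "[r, u, r] @ [v, r] \<approx> [?s] @ [v, ?t]"
    using assms by (intro pg_append pg_mult_conj pg_conj)
  finally show ?thesis by simp
qed

lemma pg_class_eq_iff:
  "u \<in> lists P - {[]} \<Longrightarrow> v \<in> lists P - {[]} \<Longrightarrow> pg_class u = pg_class v \<longleftrightarrow> u \<approx> v"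
  unfolding pg_eq_def by (rule word_cong_class_eq_iff[OF nonempty_lists_append_closed])

lemma carrier_PG: "carrier (PG P \<theta>) = pg_class ` (lists P - {[]})"
  by (simp add: PG_def carrier_semigroup_presentation)

lemma mult_PG:
  "u \<in> lists P - {[]} \<Longrightarrow> v \<in> lists P - {[]} \<Longrightarrow>
    pg_class u \<cdot>\<^bsub>PG P \<theta>\<^esub> pg_class v = pg_class (u @ v)"
  unfolding PG_def by (rule mult_semigroup_presentation)

lemma pg_generator_class: "pg_generator P \<theta> p = pg_class [p]"
  by (simp add: pg_generator_def semigroup_generator_def)

sublocale PG: semigroup_carrier "PG P \<theta>"
proof
  fix a b c
  assume "a \<in> carrier (PG P \<theta>)" "b \<in> carrier (PG P \<theta>)"
  then obtain u v where uv: "a = pg_class u" "b = pg_class v"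
      "u \<in> lists P - {[]}" "v \<in> lists P - {[]}"
    by (auto simp: carrier_PG)
  note uv' = nonempty_lists_append_closed[OF uv(3,4)]
  show "a \<cdot>\<^bsub>PG P \<theta>\<^esub> b \<in> carrier (PG P \<theta>)"
    unfolding uv(1,2) mult_PG[OF uv(3,4)] carrier_PG using uv' by blast
  assume "c \<in> carrier (PG P \<theta>)"
  then obtain w where w: "c = pg_class w" "w \<in> lists P - {[]}"
    by (auto simp: carrier_PG)
  show "(a \<cdot>\<^bsub>PG P \<theta>\<^esub> b) \<cdot>\<^bsub>PG P \<theta>\<^esub> c = a \<cdot>\<^bsub>PG P \<theta>\<^esub> (b \<cdot>\<^bsub>PG P \<theta>\<^esub> c)"
    unfolding uv(1,2) w(1) mult_PG[OF uv(3,4)] mult_PG[OF uv(4) w(2)] mult_PG[OF uv' w(2)]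
      mult_PG[OF uv(3) nonempty_lists_append_closed[OF uv(4) w(2)]] by simp
qed

text \<open>The natural homomorphism from \<open>PG(P)\<close> to \<open>S\<close>, as a right action on \<open>S\<close>.\<close>

lemma foldl_mult_closed: "a \<in> carrier S \<Longrightarrow> w \<in> lists P \<Longrightarrow> foldl (\<cdot>) a w \<in> carrier S"
  by (induction w arbitrary: a) (auto simp: mult_closed projD)

lemma foldl_mult_assoc:
  "a \<in> carrier S \<Longrightarrow> b \<in> carrier S \<Longrightarrow> w \<in> lists P \<Longrightarrow> foldl (\<cdot>) (a \<cdot> b) w = a \<cdot> foldl (\<cdot>) b w"
  by (induction w arbitrary: b) (auto simp: mult_closed mult_assoc projD)

lemma foldl_mult_cong:
  assumes "u \<approx> v" "a \<in> carrier S"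
  shows "foldl (\<cdot>) a u = foldl (\<cdot>) a v"
  using assms unfolding pg_eq_def
proof (induction arbitrary: a)
  case (rel u v)
  then show ?case
    by (auto simp: pg_relations_def \<theta> sg_simps proj_mult_idem)
next
  case (append u v u' v')
  then show ?case using pg_eq_lists[of u v] by (simp add: pg_eq_def foldl_mult_closed)
qed auto

end

section \<open>Words acting on a \<open>\<D>\<close>-class\<close>

text \<open>Separates the start of a walk, which acts trivially there, from the letters that move
  the position.\<close>

lemma (in pair_wf_digraph) pawalk_verts_eq_map_snd:
  "awalk u c v \<Longrightarrow> pawalk_verts u c = u # map snd c"
  by (induction c arbitrary: u) (auto simp: awalk_Cons_iff)

locale rooted_projection_words = projection_words S \<theta>
  for S :: "('a, 'm) star_semigrp_scheme" (structure) and \<theta> :: "'a \<Rightarrow> 'a \<Rightarrow> 'a" +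
  fixes p0 :: 'a and D :: "'a set" and T :: "'a pair_pre_digraph"
  assumes root: "p0 \<in> P"
    and D_def: "D = green_D S `` {p0}"
    and spanning_tree: "rooted_spanning_tree p0 T (friendliness_digraph S D)"
begin

abbreviation PD :: "'a set" where "PD \<equiv> P \<inter> D"
abbreviation E :: "'a set" where "E \<equiv> idempotents S \<inter> D"

lemma root_in_D: "p0 \<in> D"
  using root unfolding D_def green_D_def
  by (auto intro!: r_into_trancl simp: green_R_def projD)

lemma D_closed: "a \<in> D \<Longrightarrow> (a, b) \<in> green_R S \<or> (a, b) \<in> green_L S \<Longrightarrow> b \<in> D"
  unfolding D_def green_D_def by (auto intro: trancl_into_trancl)

text \<open>A friendly pair is connected through its product: \<open>p\<close> is \<R>-related to
  \<open>p \<cdot> q\<close>, which is \<L>-related to \<open>q\<close>.\<close>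

lemma friendly_D:
  assumes "(p, q) \<in> friendliness S" "p \<in> D"
  shows "p \<in> PD" "q \<in> PD" "p \<cdot> q \<in> E"
proof -
  have "p \<cdot> q \<in> D" using D_closed[OF assms(2)] green_R_friendly[OF assms(1)] by blast
  moreover from this have "q \<in> D" using D_closed green_L_friendly[OF assms(1)] by blast
  ultimately show "p \<in> PD" "q \<in> PD" "p \<cdot> q \<in> E"
    using friendlyD[OF assms(1)] friendly_mult_idem[OF assms(1)] assms(2) by auto
qed

lemma step_closed:
  assumes "p \<in> PD" "r \<in> P" "p \<cdot> r \<cdot> p = p"
  shows "(p, r \<cdot> p \<cdot> r) \<in> friendliness S" "r \<cdot> p \<cdot> r \<in> PD" "p \<cdot> r \<in> E"
proof -
  show *: "(p, r \<cdot> p \<cdot> r) \<in> friendliness S" using assms by (auto intro: friendly_conj)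
  show "r \<cdot> p \<cdot> r \<in> PD" "p \<cdot> r \<in> E"
    using friendly_D[OF *] assms mult_conj[of p r] by auto
qed

lemma E_projections:
  assumes "e \<in> E"
  shows "e \<cdot> e\<^sup>\<star> \<in> PD" "e\<^sup>\<star> \<cdot> e \<in> PD" "e\<^sup>\<star> \<in> E"
proof -
  note F = idempotent_friendly[of e]
  have e: "e \<in> idempotents S" "e \<in> D" using assms by auto
  have "e \<cdot> e\<^sup>\<star> \<in> D"
    using D_closed[OF e(2)] green_sym(1)[OF green_R_friendly[OF F(1)]] F(2) e(1) by auto
  then show 1: "e \<cdot> e\<^sup>\<star> \<in> PD" "e\<^sup>\<star> \<cdot> e \<in> PD" using friendly_D[OF F(1)] e by auto
  have "(e\<^sup>\<star> \<cdot> e) \<cdot> (e \<cdot> e\<^sup>\<star>) = e\<^sup>\<star>"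
    using friendly_mult_star(1)[OF F(1)] F(2) e(1) by simp
  then show "e\<^sup>\<star> \<in> E" using friendly_D(3)[OF friendly_sym[OF F(1)]] e 1 by auto
qed

lemma PD_subset_E: "PD \<subseteq> E"
  by (auto simp: idempotents_def projD)

lemma tree: "pair_wf_digraph T" "pverts T = PD" "parcs T \<subseteq> friendliness S \<inter> PD \<times> PD"
  using spanning_tree
  unfolding rooted_spanning_tree_def spanning_def subgraph_def friendliness_digraph_def
  by (auto simp: pair_wf_digraph_def wf_digraph_def)

lemma tree_idempotents_subset: "tree_idempotents S T \<subseteq> E"
  using tree(3) friendly_D(3) by (fastforce simp: tree_idempotents_def)

section \<open>The presented group and its relations\<close>

abbreviation G :: "('a \<times> bool) list set monoid" where
  "G \<equiv> group_presentation E (subgroup_relations S D T)"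

abbreviation gen :: "'a \<Rightarrow> ('a \<times> bool) list set" where
  "gen \<equiv> presentation_generator E (subgroup_relations S D T)"

sublocale G: group G
  by (rule group_group_presentation)

lemma gen_closed: "e \<in> E \<Longrightarrow> gen e \<in> carrier G"
  by (rule presentation_generator_closed)

lemma subgroup_relation:
  assumes "(u, v) \<in> subgroup_relations S D T" "u \<in> lists (E \<times> UNIV)" "v \<in> lists (E \<times> UNIV)"
  shows "group_word_cong E (subgroup_relations S D T) `` {u}
    = group_word_cong E (subgroup_relations S D T) `` {v}"
  using assms by (simp add: group_presentation_eq_iff word_cong.rel)

lemma gen_one: "e \<in> tree_idempotents S T \<union> PD \<Longrightarrow> gen e = \<one>\<^bsub>G\<^esub>"
  unfolding presentation_generator_def one_group_presentation
  using tree_idempotents_subset PD_subset_E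
  by (intro subgroup_relation) (auto simp: subgroup_relations_def)

lemma gen_star:
  assumes "e \<in> E" shows "gen (e\<^sup>\<star>) = inv\<^bsub>G\<^esub> gen e"
proof -
  have "gen e = inv\<^bsub>G\<^esub> gen (e\<^sup>\<star>)"
    unfolding inv_presentation_generator[OF E_projections(3)[OF assms]]
    unfolding presentation_generator_def
    using assms E_projections(3)[OF assms]
    by (intro subgroup_relation) (auto simp: subgroup_relations_def)
  then show ?thesis using gen_closed[OF E_projections(3)[OF assms]] by simp
qed

lemma gen_linked:
  assumes "linked_square S e f g h" "e \<in> D" "f \<in> D" "g \<in> D" "h \<in> D"
  shows "inv\<^bsub>G\<^esub> gen e \<otimes>\<^bsub>G\<^esub> gen f = inv\<^bsub>G\<^esub> gen g \<otimes>\<^bsub>G\<^esub> gen h"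
proof -
  have E: "e \<in> E" "f \<in> E" "g \<in> E" "h \<in> E"
    using assms by (auto simp: linked_square_def square_def)
  have "group_word_cong E (subgroup_relations S D T) `` {[(e, False), (f, True)]}
    = group_word_cong E (subgroup_relations S D T) `` {[(g, False), (h, True)]}"
    using E assms by (intro subgroup_relation) (auto simp: subgroup_relations_def)
  then show ?thesis
    unfolding E[THEN inv_presentation_generator] unfolding presentation_generator_def
    using E by (simp add: mult_group_presentation)
qed

lemma gen_friendly_inverse:
  assumes "(p, q) \<in> friendliness S" "p \<in> D"
  shows "gen (q \<cdot> p) = inv\<^bsub>G\<^esub> gen (p \<cdot> q)"
  using gen_star[OF friendly_D(3)[OF assms]] friendly_mult_star(1)[OF assms(1)] by simp

text \<open>The idempotents \<open>u \<cdot> s\<close>, \<open>u \<cdot> t\<close>,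
  \<open>v \<cdot> s\<close>, \<open>v \<cdot> t\<close> form a square linked by \<open>r\<close>.
  Its relation is restated without inverses, since \<open>gen (s \<cdot> u)\<close> is the inverse
  of \<open>gen (u \<cdot> s)\<close>.\<close>

lemma gen_friendly_linked:
  assumes "r \<in> P" "u \<in> D" "(u, s) \<in> friendliness S" "(u, t) \<in> friendliness S"
    "(v, s) \<in> friendliness S" "(v, t) \<in> friendliness S" "s = r \<cdot> u \<cdot> r" "t = r \<cdot> v \<cdot> r"
  shows "gen (s \<cdot> u) \<otimes>\<^bsub>G\<^esub> gen (u \<cdot> t) = gen (s \<cdot> v) \<otimes>\<^bsub>G\<^esub> gen (v \<cdot> t)"
proof -
  have v: "v \<in> D" using friendly_D(2)[OF assms(3,2)] friendly_D(2)[OF friendly_sym[OF assms(5)]] by auto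
  have carr: "u \<in> carrier S" "v \<in> carrier S" "r \<in> carrier S" "u \<cdot> s \<in> carrier S" "v \<cdot> t \<in> carrier S"
    using friendlyD[OF assms(3)] friendlyD[OF assms(6)] assms(1) by (auto intro: mult_closed projD)
  have R: "(u \<cdot> s, u \<cdot> t) \<in> green_R S" "(v \<cdot> s, v \<cdot> t) \<in> green_R S"
    and L: "(u \<cdot> s, v \<cdot> s) \<in> green_L S" "(u \<cdot> t, v \<cdot> t) \<in> green_L S"
    using assms(3-6)[THEN green_R_friendly] assms(3-6)[THEN green_L_friendly]
    by (auto simp: green_R_def green_L_def)
  have "r \<cdot> (u \<cdot> s) \<cdot> (u \<cdot> s)\<^sup>\<star> \<cdot> r = s"
    using carr friendly_mult_star(2)[OF assms(3)] assms(7) by (simp add: mult_assoc star_closed)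
  moreover have "r \<cdot> (v \<cdot> t) \<cdot> (v \<cdot> t)\<^sup>\<star> \<cdot> r = t"
    using carr friendly_mult_star(2)[OF assms(6)] assms(8) by (simp add: mult_assoc star_closed)
  ultimately have "linked_square S (u \<cdot> s) (u \<cdot> t) (v \<cdot> s) (v \<cdot> t)"
    unfolding linked_square_def square_def
    using R L assms(1) friendly_mult_idem assms(3-6) friendly_mult_star(3)[OF assms(3)]
      friendly_mult_star(3)[OF assms(6)] by auto
  from gen_linked[OF this] show ?thesis
    using friendly_D(3)[OF assms(3,2)] friendly_D(3)[OF assms(4,2)]
      friendly_D(3)[OF assms(5) v] friendly_D(3)[OF assms(6) v]
      gen_friendly_inverse[OF assms(3,2)] gen_friendly_inverse[OF assms(5) v] by auto
qed

section \<open>The partial action of words on positions paired with group elements\<close>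

definition step :: "'a \<Rightarrow> 'a \<times> ('a \<times> bool) list set \<Rightarrow> ('a \<times> ('a \<times> bool) list set) option" where
  "step r = (\<lambda>(p, g). if p \<cdot> r \<cdot> p = p then Some (r \<cdot> p \<cdot> r, g \<otimes>\<^bsub>G\<^esub> gen (p \<cdot> r)) else None)"

primrec act :: "'a list \<Rightarrow> 'a \<times> ('a \<times> bool) list set \<Rightarrow> ('a \<times> ('a \<times> bool) list set) option" where
  "act [] s = Some s"
| "act (r # w) s = Option.bind (step r s) (act w)"

lemma act_append: "act (u @ v) s = Option.bind (act u s) (act v)"
  by (induction u arbitrary: s) (auto split: bind_split)

lemma act_closed:
  assumes "act w (p, g) = Some (q, h)" "w \<in> lists P" "p \<in> PD" "g \<in> carrier G"
  shows "q \<in> PD \<and> h \<in> carrier G"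
  using assms
proof (induction w arbitrary: p g)
  case (Cons r w)
  then have r: "p \<cdot> r \<cdot> p = p" "act w (r \<cdot> p \<cdot> r, g \<otimes>\<^bsub>G\<^esub> gen (p \<cdot> r)) = Some (q, h)"
    by (auto simp: step_def split: if_splits)
  then show ?case
    using Cons step_closed[of p r] by (intro Cons.IH[OF r(2)]) (auto intro: gen_closed)
qed auto

lemma act_friendly:
  assumes "(p, q) \<in> friendliness S" "p \<in> D"
  shows "step q (p, g) = Some (q, g \<otimes>\<^bsub>G\<^esub> gen (p \<cdot> q))"
  using friendlyD[OF assms(1)] by (simp add: step_def)

lemma act_self:
  assumes "p \<in> PD" "g \<in> carrier G" shows "step p (p, g) = Some (p, g)"
  using assms act_friendly[OF friendly_refl[of p]] gen_one[of p] by (simp add: projD)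

text \<open>Writes the group factor as the generator of a friendly pair, the form in which
  \<open>gen_friendly_linked\<close> applies.\<close>

lemma step_some:
  assumes "p \<in> P" "r \<in> P" "p \<cdot> r \<cdot> p = p"
  shows "step r (p, g) = Some (r \<cdot> p \<cdot> r, g \<otimes>\<^bsub>G\<^esub> gen (p \<cdot> (r \<cdot> p \<cdot> r)))"
  unfolding mult_conj[OF assms(1,2)] using assms by (simp add: step_def)

lemma step_none: "p \<cdot> r \<cdot> p \<noteq> p \<Longrightarrow> step r (p, g) = None"
  by (simp add: step_def)

text \<open>Either \<open>q\<close> and then \<open>r\<close> can act at \<open>p\<close>, and
  \<open>two_steps\<close> describes all further moves, or none of the four words acts at
  \<open>p\<close>.\<close>

lemma act_relations:
  assumes P: "p \<in> PD" "q \<in> P" "r \<in> P" and g: "g \<in> carrier G"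
  shows "act [q, r, q, r] (p, g) = act [q, r] (p, g) \<and> act [q, r, q] (p, g) = act [q \<cdot> r \<cdot> q] (p, g)"
proof (cases "p \<cdot> q \<cdot> p = p \<and> (q \<cdot> p \<cdot> q) \<cdot> r \<cdot> (q \<cdot> p \<cdot> q) = q \<cdot> p \<cdot> q")
  case True
  define p1 p2 p3 where "p1 = q \<cdot> p \<cdot> q" and "p2 = r \<cdot> p1 \<cdot> r" and "p3 = q \<cdot> p2 \<cdot> q"
  note defs = this
  have pP: "p \<in> P" using P by simp
  have p1: "p \<cdot> q \<cdot> p = p" and p2: "p1 \<cdot> r \<cdot> p1 = p1" using True by (auto simp: p1_def)
  note two = two_steps[OF pP P(2,3) p1 p1_def p2 p2_def p3_def]
  note c1 = step_closed[OF P(1,2) p1, folded p1_def]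
  note c2 = step_closed[OF c1(2) P(3) p2, folded p2_def]
  note c3 = step_closed[OF c2(2) P(2) two(1), folded p3_def]
  have qrq: "q \<cdot> r \<cdot> q \<in> P" using P by (intro conj_proj)
  note c4 = step_closed[OF P(1) qrq two(5), folded two(4)]
  note c = c1(1) c2(1) c3(1) c4(1)
  have D: "p \<in> D" "p1 \<in> D" "p2 \<in> D" "p3 \<in> D" "p1 \<in> P" "p2 \<in> P" "p3 \<in> P"
    using P(1) c1(2) c2(2) c3(2) by auto
  have a: "gen (p \<cdot> p1) \<in> carrier G" "gen (p1 \<cdot> p2) \<in> carrier G" "gen (p2 \<cdot> p3) \<in> carrier G"
     "gen (p \<cdot> p3) \<in> carrier G"
    using c D by (auto intro!: gen_closed friendly_D(3))
  have s1: "step q (p, g) = Some (p1, g \<otimes>\<^bsub>G\<^esub> gen (p \<cdot> p1))"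
    unfolding p1_def by (rule step_some[OF pP P(2) p1])
  have s2: "step r (p1, g) = Some (p2, g \<otimes>\<^bsub>G\<^esub> gen (p1 \<cdot> p2))" for g
    unfolding p2_def by (rule step_some[OF D(5) P(3) p2])
  have s3: "step q (p2, g) = Some (p3, g \<otimes>\<^bsub>G\<^esub> gen (p2 \<cdot> p3))" for g
    unfolding p3_def by (rule step_some[OF D(6) P(2) two(1)])
  have s4: "step r (p3, g) = Some (p2, g \<otimes>\<^bsub>G\<^esub> gen (p3 \<cdot> p2))" for g
    using step_some[OF D(7) P(3) two(3)] unfolding two(2) .
  have s5: "step (q \<cdot> r \<cdot> q) (p, g) = Some (p3, g \<otimes>\<^bsub>G\<^esub> gen (p \<cdot> p3))"
    using step_some[OF pP qrq two(5)] unfolding two(4)[symmetric] .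
  \<comment> \<open>A second \<open>q\<close>, \<open>r\<close> goes from \<open>p2\<close> to
    \<open>p3\<close> and back, so its two generators cancel.\<close>
  have i: "gen (p3 \<cdot> p2) = inv\<^bsub>G\<^esub> gen (p2 \<cdot> p3)" "gen (p1 \<cdot> p) = inv\<^bsub>G\<^esub> gen (p \<cdot> p1)"
    using gen_friendly_inverse c D by auto
  \<comment> \<open>The square has rows for \<open>p\<close> and \<open>p2\<close>, columns for
    \<open>p1\<close> and \<open>p3\<close>, and is linked by \<open>q\<close>.\<close>
  have "gen (p1 \<cdot> p) \<otimes>\<^bsub>G\<^esub> gen (p \<cdot> p3) = gen (p1 \<cdot> p2) \<otimes>\<^bsub>G\<^esub> gen (p2 \<cdot> p3)"
    by (rule gen_friendly_linked[OF P(2) D(1) c(1,4) friendly_sym[OF c(2)] c(3) p1_def p3_def])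
  then have *: "gen (p \<cdot> p3) = gen (p \<cdot> p1) \<otimes>\<^bsub>G\<^esub> (gen (p1 \<cdot> p2) \<otimes>\<^bsub>G\<^esub> gen (p2 \<cdot> p3))"
    unfolding i using a by (metis G.inv_solve_left G.m_closed)
  show ?thesis
    using a g by (simp add: s1 s2 s3 s4 s5 i * G.m_assoc)
next
  case False
  have "p \<cdot> (q \<cdot> r \<cdot> q) \<cdot> p \<noteq> p" using False conj_conj_absorb[of p q r] P by auto
  then show ?thesis
    using False by (auto simp: step_none step_def)
qed

text \<open>Induction on the congruence with the state left arbitrary: in the \<open>append\<close>
  case the second factors start from the state reached by the first, which \<open>act_closed\<close>
  keeps in \<open>PD\<close> and \<open>G\<close>.\<close>

lemma act_cong:
  assumes "u \<approx> v" "p \<in> PD" "g \<in> carrier G"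
  shows "act u (p, g) = act v (p, g)"
  using assms unfolding pg_eq_def
proof (induction arbitrary: p g)
  case (rel u v)
  from rel(1) consider q where "q \<in> P" "u = [q, q]" "v = [q]"
    | q r where "q \<in> P" "r \<in> P" "u = [q, r, q, r]" "v = [q, r]"
    | q r where "q \<in> P" "r \<in> P" "u = [q, r, q]" "v = [q \<cdot> r \<cdot> q]"
    by (auto simp: pg_relations_def \<theta>)
  then show ?case
  proof cases
    case 1
    show ?thesis
    proof (cases "p \<cdot> q \<cdot> p = p")
      case True
      have "q \<cdot> p \<cdot> q \<in> PD" "p \<cdot> q \<in> E" using step_closed[of p q] True rel 1 by auto
      \<comment> \<open>A second \<open>q\<close> leaves \<open>q \<cdot> p \<cdot> q\<close> fixed
        and contributes the generator of this projection, which is trivial.\<close>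
      moreover have "q \<cdot> p \<cdot> q \<cdot> q \<cdot> (q \<cdot> p \<cdot> q) = q \<cdot> p \<cdot> q"
        "q \<cdot> (q \<cdot> p \<cdot> q) \<cdot> q = q \<cdot> p \<cdot> q" "q \<cdot> p \<cdot> q \<cdot> q = q \<cdot> p \<cdot> q"
        using calculation 1 rel(4) by (auto simp: sg_simps proj_mult_idem')
      ultimately show ?thesis
        using 1 True rel gen_one[of "q \<cdot> p \<cdot> q"] gen_closed[of "p \<cdot> q"] by (simp add: step_def)
    qed (use 1 in \<open>simp add: step_none\<close>)
  qed (use act_relations[of p _ _ g] rel in auto)
next
  case (append u v u' v')
  have lists: "u \<in> lists P" "v \<in> lists P"
    using append.hyps pg_eq_lists[of u v] by (auto simp: pg_eq_def)
  show ?case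
    unfolding act_append append.IH(1)[OF append.prems]
    using act_closed[OF _ lists(2) append.prems] append.IH(2) by (auto split: bind_split)
qed auto

text \<open>Links the position to multiplication in \<open>S\<close>: right multiplication of
  \<open>a\<close> by \<open>r\<close> turns \<open>a\<^sup>\<star> \<cdot> a\<close> into
  \<open>r \<cdot> (a\<^sup>\<star> \<cdot> a) \<cdot> r\<close>, exactly as a step does.\<close>

lemma act_foldl:
  assumes "act w (p, g) = Some (q, h)" "w \<in> lists P" "a \<in> carrier S" "a\<^sup>\<star> \<cdot> a = p"
  shows "(foldl (\<cdot>) a w)\<^sup>\<star> \<cdot> foldl (\<cdot>) a w = q"
  using assms
proof (induction w arbitrary: p g a)
  case (Cons r w)
  then have r: "p \<cdot> r \<cdot> p = p" "act w (r \<cdot> p \<cdot> r, g \<otimes>\<^bsub>G\<^esub> gen (p \<cdot> r)) = Some (q, h)"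
    by (auto simp: step_def split: if_splits)
  have rP: "r \<in> P" using Cons.prems by simp
  have "(a \<cdot> r)\<^sup>\<star> \<cdot> (a \<cdot> r) = r \<cdot> p \<cdot> r"
    using Cons.prems(3) rP unfolding Cons.prems(4)[symmetric] by (simp add: sg_simps)
  then show ?case using Cons.IH[OF r(2)] Cons.prems rP by (simp add: mult_closed projD)
qed auto


section \<open>Walks in the spanning tree\<close>

text \<open>Arcs may be traversed in both directions, as needed for walks back to
  \<open>p0\<close>.\<close>

abbreviation M :: "'a pair_pre_digraph" where "M \<equiv> mk_symmetric (with_proj T)"

sublocale M: pair_wf_digraph M
  using tree(1) by (intro wf_digraph.wellformed_mk_symmetric) (simp add: wf_digraph_def pair_wf_digraph_def)

text \<open>A reversed tree arc has as generator the inverse of a trivial one.\<close>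

lemma parcs_M:
  assumes "(u, v) \<in> parcs M"
  shows "(u, v) \<in> friendliness S" "u \<in> PD" "v \<in> PD" "gen (u \<cdot> v) = \<one>\<^bsub>G\<^esub>"
proof -
  have *: "(x, y) \<in> friendliness S" "x \<in> PD" "y \<in> PD" "gen (x \<cdot> y) = \<one>\<^bsub>G\<^esub>" if "(x, y) \<in> parcs T" for x y
    using that tree(3) gen_one[of "x \<cdot> y"] by (auto simp: tree_idempotents_def)
  have "(u, v) \<in> parcs T \<or> (v, u) \<in> parcs T"
    using assms by (auto simp: parcs_mk_symmetric)
  then show "(u, v) \<in> friendliness S" "u \<in> PD" "v \<in> PD" "gen (u \<cdot> v) = \<one>\<^bsub>G\<^esub>"
    using *[of u v] *[of v u] friendly_sym[of v u] gen_friendly_inverse[of v u] by auto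
qed

lemma parcs_tree_subset: "(u, v) \<in> parcs T \<Longrightarrow> (u, v) \<in> parcs M"
  by (auto simp: parcs_mk_symmetric)

lemma walk_lists: "M.awalk u c v \<Longrightarrow> pawalk_verts u c \<in> lists P - {[]}"
  using M.awalk_verts_in_verts[of u c] M.awalk_verts_non_Nil[of u c]
  by (auto simp: M.awalk_def tree(2))

text \<open>Tree arcs have trivial generators, so a walk moves only the position and leaves the
  group component alone.\<close>

lemma walk_act:
  assumes "M.awalk u c v" "g \<in> carrier G"
  shows "act (pawalk_verts u c) (u, g) = Some (v, g)"
proof -
  have "act (map snd c) (u, g) = Some (v, g)"
    using assms(1)
  proof (induction c arbitrary: u)
    case (Cons a c)
    then obtain x where x: "a = (u, x)" "(u, x) \<in> parcs M" "M.awalk x c v"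
      by (cases a) (auto simp: M.awalk_Cons_iff)
    then show ?case
      using act_friendly[OF parcs_M(1)[OF x(2)]] parcs_M[OF x(2)] Cons.IH[OF x(3)] assms(2) by simp
  qed (auto simp: M.awalk_Nil_iff)
  moreover have "u \<in> PD" using assms(1) by (auto simp: M.awalk_def tree(2))
  ultimately show ?thesis
    using assms act_self[of u g] by (simp add: M.pawalk_verts_eq_map_snd[OF assms(1)])
qed

text \<open>The vertex \<open>v\<close> shared by both walks appears twice on the left;
  \<open>pg_idem\<close> merges the copies.\<close>

lemma walk_append:
  assumes "M.awalk u c v" "M.awalk v d w"
  shows "pawalk_verts u c @ pawalk_verts v d \<approx> pawalk_verts u (c @ d)"
  using assms(1)
proof (induction c arbitrary: u)
  case Nil
  then have u: "u = v" "u \<in> P" by (auto simp: M.awalk_Nil_iff tree(2))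
  have "map snd d \<in> lists P"
    using walk_lists[OF assms(2)] unfolding M.pawalk_verts_eq_map_snd[OF assms(2)] by simp
  then show ?case
    using pg_context[OF pg_idem[OF u(2)], of "[]" "map snd d"] u
    by (simp add: M.pawalk_verts_eq_map_snd[OF assms(2)])
next
  case (Cons a c)
  then have a: "a \<in> parcs M" "u = fst a" "M.awalk (snd a) c v" by (auto simp: M.awalk_Cons_iff)
  have "u \<in> P" using Cons.prems by (auto simp: M.awalk_def tree(2))
  then show ?case
    using pg_context[OF Cons.IH[OF a(3)], of "[u]" "[]"] a(2) by simp
qed

text \<open>Induction on the length. A nonempty closed walk is either a cycle, which in a tree just
  runs along an edge and back, or contains a shorter nonempty closed walk; contracting that one
  leaves a shorter closed walk again.\<close>

lemma closed_walk:
  assumes "M.awalk u c u" shows "pawalk_verts u c \<approx> [u]"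
  using assms
proof (induction "length c" arbitrary: u c rule: less_induct)
  case less
  have u: "u \<in> P" using less.prems by (auto simp: M.awalk_def tree(2))
  show ?case
  proof (cases c)
    case Nil
    then show ?thesis using u by (auto intro: pg_refl)
  next
    case (Cons a c')
    have a: "a \<in> parcs M" "u = fst a" "M.awalk (snd a) c' u"
      using less.prems by (auto simp: Cons M.awalk_Cons_iff)
    show ?thesis
    proof (cases "distinct (pawalk_verts (snd a) c')")
      case True
      \<comment> \<open>For a cycle only the vertices after the first must be distinct, and these
        are the vertices of \<open>c'\<close>.\<close>
      then have "M.cycle c"
        using less.prems unfolding M.cycle_def by (auto simp: Cons)
      then have "length c = 2"
        using spanning_tree by (auto simp: rooted_spanning_tree_def undirected_tree_def)
      then obtain b where c': "c' = [b]" by (auto simp: Cons length_Suc_conv numeral_2_eq_2)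
      have "pawalk_verts u c = [u, snd a, u]"
        using a(3) by (auto simp: Cons c' a(2) M.awalk_Cons_iff M.awalk_Nil_iff)
      then show ?thesis using pg_friendly parcs_M(1)[of u "snd a"] a(1,2) by simp
    next
      case False
      \<comment> \<open>Both inductive calls decrease the length: \<open>r\<close> lacks the arc
        \<open>a\<close>, and \<open>(a # q) @ s\<close> lacks the nonempty
        \<open>r\<close>.\<close>
      then obtain q r s w where qrs: "c' = q @ r @ s" "0 < length r"
          "M.awalk (snd a) q w" "M.awalk w r w" "M.awalk w s u"
        using M.awalk_not_distinct_decomp[OF a(3)] by auto
      have aq: "M.awalk u (a # q) w" using a qrs(3) by (simp add: M.awalk_Cons_iff)
      have wP: "w \<in> P" using qrs(5) by (auto simp: M.awalk_def tree(2))
      let ?x = "pawalk_verts u (a # q)" and ?y = "pawalk_verts w s"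
      have lists: "?x \<in> lists P" "?y \<in> lists P"
        using walk_lists[OF aq] walk_lists[OF qrs(5)] by auto
      have "pawalk_verts u c \<approx> ?x @ pawalk_verts w (r @ s) @ []"
        using pg_sym[OF walk_append[OF aq M.awalk_appendI[OF qrs(4,5)]]] by (simp add: Cons qrs(1))
      also have "\<dots> \<approx> ?x @ (pawalk_verts w r @ ?y) @ []"
        by (rule pg_context[OF pg_sym[OF walk_append[OF qrs(4,5)]] lists(1)]) simp
      also have "?x @ (pawalk_verts w r @ ?y) @ [] = ?x @ pawalk_verts w r @ ?y" by simp
      also have "\<dots> \<approx> ?x @ [w] @ ?y"
        using qrs aq by (intro pg_context less.hyps lists) (auto simp: Cons)
      also have "?x @ [w] @ ?y = ?x @ ([w] @ ?y) @ []" by simp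
      also have "\<dots> \<approx> ?x @ ?y @ []"
        using walk_append[of w "[]" w s u] qrs(5) lists wP
        by (intro pg_context) (auto simp: M.awalk_Nil_iff M.awalk_def)
      also have "?x @ ?y @ [] = ?x @ ?y" by simp
      also have "\<dots> \<approx> pawalk_verts u ((a # q) @ s)" by (rule walk_append[OF aq qrs(5)])
      also have "\<dots> \<approx> [u]"
        using qrs aq by (intro less.hyps M.awalk_appendI) (auto simp: Cons)
      finally show ?thesis .
    qed
  qed
qed


section \<open>The isomorphism\<close>

lemma walk_exists:
  assumes "u \<in> PD" "v \<in> PD" shows "\<exists>c. M.awalk u c v"
proof -
  have "p0 \<rightarrow>\<^sup>*\<^bsub>M\<^esub> x" if "x \<in> PD" for x
    using that tree(1,2) spanning_tree
    by (auto simp: rooted_spanning_tree_def wf_digraph_def pair_wf_digraph_def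
        intro!: wf_digraph.reachable_mk_symmetricI)
  then have "u \<rightarrow>\<^sup>*\<^bsub>M\<^esub> v"
    using M.reachable_trans[OF symmetric_reachable[OF symmetric_mk_symmetric]] assms by blast
  then show ?thesis by (simp add: M.reachable_awalk)
qed

text \<open>With a return walk \<open>f\<close> from \<open>v\<close> to \<open>u\<close>, the walk
  \<open>c @ f @ d\<close> contracts to \<open>c\<close> through the closed walk
  \<open>f @ d\<close> and to \<open>d\<close> through the closed walk \<open>c @ f\<close>.\<close>

lemma walks_equiv:
  assumes c: "M.awalk u c v" and d: "M.awalk u d v"
  shows "pawalk_verts u c \<approx> pawalk_verts u d"
proof -
  have uv: "u \<in> PD" "v \<in> PD"
    using M.awalk_hd_in_verts[OF c] M.awalk_last_in_verts[OF c] tree(2) by auto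
  then have u: "M.awalk u [] u" and v: "M.awalk v [] v"
    using tree(2) by (auto simp: M.awalk_Nil_iff)
  obtain f where f: "M.awalk v f u" using walk_exists uv by blast
  note fd = M.awalk_appendI[OF f d] and cf = M.awalk_appendI[OF c f]
  have "pawalk_verts u c \<approx> pawalk_verts u c @ [v]"
    using pg_sym[OF walk_append[OF c v]] by simp
  also have "\<dots> \<approx> pawalk_verts u c @ pawalk_verts v (f @ d)"
    using walk_lists[OF c] by (intro pg_append pg_refl pg_sym[OF closed_walk[OF fd]]) auto
  also have "\<dots> \<approx> pawalk_verts u ((c @ f) @ d)"
    using walk_append[OF c fd] by simp
  also have "\<dots> \<approx> pawalk_verts u (c @ f) @ pawalk_verts u d"
    by (rule pg_sym[OF walk_append[OF cf d]])
  also have "\<dots> \<approx> [u] @ pawalk_verts u d"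
    using walk_lists[OF d] by (intro pg_append pg_refl closed_walk[OF cf]) auto
  also have "\<dots> \<approx> pawalk_verts u d"
    using walk_append[OF u d] by simp
  finally show ?thesis .
qed

text \<open>The chosen walk is immaterial up to \<approx>, by \<open>walks_equiv\<close>.\<close>

definition path_word :: "'a \<Rightarrow> 'a \<Rightarrow> 'a list" where
  "path_word u v = pawalk_verts u (SOME c. M.awalk u c v)"

lemma path_word_walk:
  assumes "u \<in> PD" "v \<in> PD"
  obtains c where "M.awalk u c v" "path_word u v = pawalk_verts u c"
  using someI_ex[OF walk_exists[OF assms]] unfolding path_word_def by blast

lemma path_word_lists:
  assumes "u \<in> PD" "v \<in> PD" shows "path_word u v \<in> lists P - {[]}"
proof -
  obtain c where "M.awalk u c v" "path_word u v = pawalk_verts u c"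
    using path_word_walk[OF assms] .
  then show ?thesis using walk_lists by simp
qed

lemma path_word_act:
  assumes "u \<in> PD" "v \<in> PD" "g \<in> carrier G"
  shows "act (path_word u v) (u, g) = Some (v, g)"
proof -
  obtain c where "M.awalk u c v" "path_word u v = pawalk_verts u c"
    using path_word_walk[OF assms(1,2)] .
  then show ?thesis using walk_act assms(3) by simp
qed

lemma path_word_equiv:
  assumes "M.awalk u c v" shows "path_word u v \<approx> pawalk_verts u c"
  unfolding path_word_def using walks_equiv[OF someI[of "\<lambda>c. M.awalk u c v"] assms] assms .

lemma path_word_append:
  assumes "u \<in> PD" "v \<in> PD" "w \<in> PD"
  shows "path_word u v @ path_word v w \<approx> path_word u w"
proof -
  obtain c where c: "M.awalk u c v" "path_word u v = pawalk_verts u c"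
    using path_word_walk[OF assms(1,2)] .
  obtain d where d: "M.awalk v d w" "path_word v w = pawalk_verts v d"
    using path_word_walk[OF assms(2,3)] .
  show ?thesis
    unfolding c(2) d(2)
    by (rule pg_trans[OF walk_append[OF c(1) d(1)] pg_sym[OF path_word_equiv]])
      (rule M.awalk_appendI[OF c(1) d(1)])
qed

lemma path_word_refl:
  assumes "u \<in> PD" shows "path_word u u \<approx> [u]"
proof -
  have "M.awalk u [] u" using assms by (simp add: M.awalk_Nil_iff tree(2))
  from path_word_equiv[OF this] show ?thesis by simp
qed

lemma path_word_arc:
  assumes "(u, v) \<in> parcs T" shows "path_word u v \<approx> [u, v]"
proof -
  note uv = parcs_tree_subset[OF assms]
  have "M.awalk u [(u, v)] v"
    using uv parcs_M(2,3)[OF uv] by (simp add: M.awalk_Cons_iff M.awalk_Nil_iff tree(2))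
  from path_word_equiv[OF this] show ?thesis by simp
qed

section \<open>Loops at the root satisfy the group relations\<close>

lemma root_PD: "p0 \<in> PD"
  using root root_in_D by blast

text \<open>Going from \<open>q\<close> to \<open>p0\<close> and back is a closed tree walk, so such
  a trip can be inserted or removed wherever the letter \<open>q\<close> stands.\<close>

lemma detour:
  assumes "q \<in> PD" "x \<in> lists P" "y \<in> lists P"
  shows "x @ [q] @ path_word q p0 @ path_word p0 q @ [q] @ y \<approx> x @ [q] @ y"
proof -
  have q: "q \<in> P" using assms by simp
  have "[q] @ (path_word q p0 @ path_word p0 q) @ [q] \<approx> [q] @ [q] @ [q]"
    using assms path_word_append[OF assms(1) root_PD assms(1)] path_word_refl[OF assms(1)]
    by (intro pg_context) (auto intro: pg_trans)
  also have "\<dots> \<approx> [q] @ [q]"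
    using pg_context[OF pg_idem[OF q], of "[q]" "[]"] q by simp
  also have "\<dots> \<approx> [q]" using pg_idem[OF q] by simp
  finally show ?thesis using pg_context[OF _ assms(2,3)] by fastforce
qed

text \<open>The word that is to represent \<open>gen e\<close> in \<open>PG P \<theta>\<close>; the
  middle letters are the friendly pair of \<open>e\<close>.\<close>

definition loop :: "'a \<Rightarrow> 'a list" where
  "loop e = path_word p0 (e \<cdot> e\<^sup>\<star>) @ [e \<cdot> e\<^sup>\<star>, e\<^sup>\<star> \<cdot> e] @ path_word (e\<^sup>\<star> \<cdot> e) p0"

lemma loop_lists: "e \<in> E \<Longrightarrow> loop e \<in> lists P - {[]}"
  using path_word_lists[OF root_PD E_projections(1)] path_word_lists[OF E_projections(2) root_PD]
    E_projections(1,2)[of e]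
  by (auto simp: loop_def)

lemma loop_friendly:
  assumes "(p, q) \<in> friendliness S"
  shows "loop (p \<cdot> q) = path_word p0 p @ [p, q] @ path_word q p0"
  unfolding loop_def friendly_mult_star(2,3)[OF assms] ..

text \<open>If \<open>[p, q]\<close> can be replaced by a tree walk, the whole loop becomes a closed
  tree walk at \<open>p0\<close>.\<close>

lemma loop_trivial_of_path:
  assumes "(p, q) \<in> friendliness S" "p \<in> PD" "q \<in> PD" "path_word p q \<approx> [p, q]"
  shows "loop (p \<cdot> q) \<approx> [p0]"
proof -
  have "loop (p \<cdot> q) \<approx> path_word p0 p @ path_word p q @ path_word q p0"
    unfolding loop_friendly[OF assms(1)]
    using path_word_lists[OF root_PD assms(2)] path_word_lists[OF assms(3) root_PD]
    by (intro pg_context pg_sym[OF assms(4)]) auto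
  also have "\<dots> \<approx> path_word p0 p @ path_word p p0"
    using path_word_lists[OF root_PD assms(2)]
    by (intro pg_append pg_refl path_word_append assms root_PD) auto
  also have "\<dots> \<approx> path_word p0 p0" by (intro path_word_append assms root_PD)
  also have "\<dots> \<approx> [p0]" by (rule path_word_refl[OF root_PD])
  finally show ?thesis .
qed

lemma loop_trivial:
  assumes "e \<in> tree_idempotents S T \<union> PD" shows "loop e \<approx> [p0]"
  using assms
proof
  assume "e \<in> tree_idempotents S T"
  then obtain p q where "(p, q) \<in> parcs T" "e = p \<cdot> q" by (auto simp: tree_idempotents_def)
  then show ?thesis using loop_trivial_of_path[of p q] path_word_arc tree(3) by auto
next
  assume e: "e \<in> PD"
  then have "path_word e e \<approx> [e, e]"
    using path_word_refl[OF e] pg_sym[OF pg_idem[of e]] by (auto intro: pg_trans)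
  then show ?thesis
    using e loop_trivial_of_path[of e e] friendly_refl[of e] by (auto simp: projD)
qed

text \<open>The return from \<open>q\<close> at the end of the first loop and the way out to
  \<open>q\<close> in the second form a \<open>detour\<close>.\<close>

lemma loop_mult:
  assumes "(p, q) \<in> friendliness S" "(q, r) \<in> friendliness S" "p \<in> D"
  shows "loop (p \<cdot> q) @ loop (q \<cdot> r) \<approx> path_word p0 p @ [p, q, r] @ path_word r p0"
proof -
  have p: "p \<in> PD" and q: "q \<in> PD" and r: "r \<in> PD"
    using friendly_D[OF assms(1,3)] friendly_D[OF assms(2)] by auto
  show ?thesis
    using detour[OF q, of "path_word p0 p @ [p]" "[r] @ path_word r p0"] p r
      path_word_lists[OF root_PD p] path_word_lists[OF r root_PD]
    by (simp add: loop_friendly[OF assms(1)] loop_friendly[OF assms(2)])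
qed

text \<open>The product runs from \<open>p\<close> to \<open>q\<close> and back; friendliness
  contracts this to \<open>p\<close>, leaving the trivial loop of a projection.\<close>

lemma loop_star:
  assumes "e \<in> E" shows "loop e @ loop (e\<^sup>\<star>) \<approx> [p0]"
proof -
  define p q where "p = e \<cdot> e\<^sup>\<star>" and "q = e\<^sup>\<star> \<cdot> e"
  have F: "(p, q) \<in> friendliness S" and e: "p \<cdot> q = e"
    using idempotent_friendly[of e] assms by (auto simp: p_def q_def)
  have p: "p \<in> PD" using E_projections[OF assms] by (simp add: p_def)
  have e': "q \<cdot> p = e\<^sup>\<star>" using friendly_mult_star(1)[OF F] e by simp
  have l: "path_word p0 p \<in> lists P" "path_word p p0 \<in> lists P"
    using path_word_lists[OF root_PD p] path_word_lists[OF p root_PD] by auto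
  have "loop e @ loop (e\<^sup>\<star>) \<approx> path_word p0 p @ [p, q, p] @ path_word p p0"
    using loop_mult[OF F friendly_sym[OF F]] p unfolding e e' by simp
  also have "\<dots> \<approx> path_word p0 p @ [p, p] @ path_word p p0"
    using p by (intro pg_context l pg_trans[OF pg_friendly[OF F]] pg_sym[OF pg_idem]) auto
  also have "path_word p0 p @ [p, p] @ path_word p p0 = loop (p \<cdot> p)"
    using p by (simp add: loop_friendly friendly_refl)
  also have "\<dots> \<approx> [p0]" using p loop_trivial[of p] by (simp add: projD)
  finally show ?thesis .
qed

text \<open>Between the same tree walks the two products read \<open>[s, u, t]\<close> and
  \<open>[s, v, t]\<close>, which \<open>pg_linked\<close> identifies.\<close>

lemma loop_linked:
  assumes "linked_square S e f g h" "e \<in> D" "f \<in> D" "g \<in> D" "h \<in> D"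
  shows "loop (e\<^sup>\<star>) @ loop f \<approx> loop (g\<^sup>\<star>) @ loop h"
proof -
  have sq: "e \<in> idempotents S" "f \<in> idempotents S" "g \<in> idempotents S" "h \<in> idempotents S"
      "(e, f) \<in> green_R S" "(g, h) \<in> green_R S" "(e, g) \<in> green_L S" "(f, h) \<in> green_L S"
    using assms(1) by (auto simp: linked_square_def square_def)
  obtain r where r: "r \<in> P" "r \<cdot> e \<cdot> e\<^sup>\<star> \<cdot> r = e\<^sup>\<star> \<cdot> e" "r \<cdot> h \<cdot> h\<^sup>\<star> \<cdot> r = h\<^sup>\<star> \<cdot> h"
    using assms(1) by (auto simp: linked_square_def)
  \<comment> \<open>Idempotents in one row share their first projection, those in one column their
    second, so four projections describe the square.\<close>
  define u v s t where "u = e \<cdot> e\<^sup>\<star>" and "v = h \<cdot> h\<^sup>\<star>" and "s = e\<^sup>\<star> \<cdot> e" and "t = h\<^sup>\<star> \<cdot> h"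
  note defs = this
  have eqs: "u = f \<cdot> f\<^sup>\<star>" "v = g \<cdot> g\<^sup>\<star>" "s = g\<^sup>\<star> \<cdot> g" "t = f\<^sup>\<star> \<cdot> f"
    using green_R_mult_star[OF sq(5)] green_R_mult_star[OF sq(6)]
      green_L_star_mult[OF sq(7)] green_L_star_mult[OF sq(8)] by (simp_all add: defs)
  have F: "(u, s) \<in> friendliness S" "(u, t) \<in> friendliness S" "(v, s) \<in> friendliness S"
      "(v, t) \<in> friendliness S"
    and prods: "u \<cdot> s = e" "u \<cdot> t = f" "v \<cdot> s = g" "v \<cdot> t = h"
    using idempotent_friendly[OF sq(1)] idempotent_friendly[OF sq(2)] idempotent_friendly[OF sq(3)]
      idempotent_friendly[OF sq(4)]
    by (simp_all add: defs(1,3)[symmetric] eqs[symmetric]) (simp_all add: defs(2,4)[symmetric])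
  have stars: "s \<cdot> u = e\<^sup>\<star>" "s \<cdot> v = g\<^sup>\<star>"
    using friendly_mult_star(1)[OF F(1)] friendly_mult_star(1)[OF F(3)] prods by simp_all
  have P: "u \<in> P" "v \<in> P" "s \<in> P" "t \<in> P" using friendlyD[OF F(1)] friendlyD[OF F(4)] by auto
  have "e \<in> E" "h \<in> E" using sq assms by auto
  then have st: "s \<in> PD" "t \<in> PD" using E_projections unfolding s_def t_def by blast+
  have "e \<in> carrier S" "h \<in> carrier S" using sq by (auto simp: idempotents_def)
  then have "s = r \<cdot> u \<cdot> r" "t = r \<cdot> v \<cdot> r"
    using r by (simp_all add: u_def v_def s_def t_def mult_assoc mult_closed star_closed projD)
  then have mid: "[s, u, t] \<approx> [s, v, t]" using pg_linked[OF r(1) P(1,2)] by simp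
  have "loop (e\<^sup>\<star>) @ loop f \<approx> path_word p0 s @ [s, u, t] @ path_word t p0"
    using loop_mult[OF friendly_sym[OF F(1)] F(2)] st unfolding stars prods by simp
  also have "\<dots> \<approx> path_word p0 s @ [s, v, t] @ path_word t p0"
    using path_word_lists[OF root_PD st(1)] path_word_lists[OF st(2) root_PD]
    by (intro pg_context mid) auto
  also have "\<dots> \<approx> loop (g\<^sup>\<star>) @ loop h"
    using pg_sym[OF loop_mult[OF friendly_sym[OF F(3)] F(4)]] st unfolding stars prods by simp
  finally show ?thesis .
qed

lemma root_loop: "e \<in> E \<Longrightarrow> [p0] @ loop e \<approx> loop e"
proof -
  assume e: "e \<in> E"
  let ?p = "path_word p0 (e \<cdot> e\<^sup>\<star>)" and ?y = "[e \<cdot> e\<^sup>\<star>, e\<^sup>\<star> \<cdot> e] @ path_word (e\<^sup>\<star> \<cdot> e) p0"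
  note p = E_projections[OF e]
  have "[p0] @ ?p \<approx> path_word p0 p0 @ ?p"
    using path_word_lists[OF root_PD p(1)]
    by (intro pg_append pg_refl pg_sym[OF path_word_refl] root_PD) auto
  also have "\<dots> \<approx> ?p" by (intro path_word_append root_PD p)
  finally have "[p0] @ ?p \<approx> ?p" .
  from pg_context[OF this, of "[]" ?y] show ?thesis
    using p path_word_lists[OF p(2) root_PD] by (simp add: loop_def)
qed

text \<open>The tree walks do not touch the group component; only the middle move from
  \<open>p\<close> to \<open>q\<close> contributes a generator.\<close>

lemma loop_act:
  assumes "e \<in> E" "g \<in> carrier G"
  shows "act (loop e) (p0, g) = Some (p0, g \<otimes>\<^bsub>G\<^esub> gen e)"
proof -
  define p q where "p = e \<cdot> e\<^sup>\<star>" and "q = e\<^sup>\<star> \<cdot> e"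
  have F: "(p, q) \<in> friendliness S" and e: "p \<cdot> q = e"
    using idempotent_friendly[of e] assms by (auto simp: p_def q_def)
  have pq: "p \<in> PD" "q \<in> PD" using E_projections[OF assms(1)] by (simp_all add: p_def q_def)
  show ?thesis
    using path_word_act[OF root_PD pq(1) assms(2)]
      path_word_act[OF pq(2) root_PD G.m_closed[OF assms(2) gen_closed[OF assms(1)]]]
      act_self[OF pq(1) assms(2)] act_friendly[OF F] pq e
    unfolding loop_def p_def[symmetric] q_def[symmetric] by (simp add: act_append)
qed

section \<open>Realizing group words in \<open>PG P \<theta>\<close>\<close>

abbreviation gwords :: "('a \<times> bool) list set" where "gwords \<equiv> lists (E \<times> UNIV)"

abbreviation gcong :: "('a \<times> bool) list rel" where
  "gcong \<equiv> group_word_cong E (subgroup_relations S D T)"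

text \<open>An inverse letter is realized by the loop of the star. The final \<open>p0\<close> gives
  the empty group word a nonempty value, the identity of the maximal subgroup.\<close>

primrec realize :: "('a \<times> bool) list \<Rightarrow> 'a list" where
  "realize [] = [p0]"
| "realize (x # w) = loop (if snd x then fst x else (fst x)\<^sup>\<star>) @ realize w"

lemma letter_E: "x \<in> E \<times> UNIV \<Longrightarrow> (if snd x then fst x else (fst x)\<^sup>\<star>) \<in> E"
  using E_projections(3)[of "fst x"] by auto

lemma realize_lists: "w \<in> gwords \<Longrightarrow> realize w \<in> lists P - {[]}"
proof (induction w rule: list.induct)
  case (Cons x w)
  then have "x \<in> E \<times> UNIV" "w \<in> gwords" by auto
  then show ?case
    using nonempty_lists_append_closed[OF loop_lists[OF letter_E] Cons.IH] by simp
qed (use root in simp)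

lemma root_realize: "w \<in> gwords \<Longrightarrow> [p0] @ realize w \<approx> realize w"
proof (induction w rule: list.induct)
  case (Cons x w)
  then have x: "x \<in> E \<times> UNIV" and w: "w \<in> gwords" by auto
  show ?case
    using pg_context[OF root_loop[OF letter_E[OF x]], of "[]" "realize w"] realize_lists[OF w]
    by simp
qed (use root in \<open>simp add: pg_idem\<close>)

lemma realize_root: "w \<in> gwords \<Longrightarrow> realize w @ [p0] \<approx> realize w"
proof (induction w rule: list.induct)
  case (Cons x w)
  then have x: "x \<in> E \<times> UNIV" and w: "w \<in> gwords" by auto
  show ?case
    using pg_context[OF Cons.IH[OF w] _, of _ "[]"] loop_lists[OF letter_E[OF x]] by simp
qed (use root in \<open>simp add: pg_idem\<close>)

lemma realize_append:
  assumes "u \<in> gwords" "v \<in> gwords" shows "realize (u @ v) \<approx> realize u @ realize v"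
  using assms(1)
proof (induction u rule: list.induct)
  case Nil
  then show ?case using pg_sym[OF root_realize[OF assms(2)]] by simp
next
  case (Cons x u)
  then have x: "x \<in> E \<times> UNIV" and u: "u \<in> gwords" by auto
  show ?case
    using pg_context[OF Cons.IH[OF u] _, of _ "[]"] loop_lists[OF letter_E[OF x]] by simp
qed

text \<open>Well-definedness of the homomorphism: each defining relation of \<open>G\<close> matches
  a property of loops, and concatenation is handled by \<open>realize_append\<close>.\<close>

lemma realize_cong:
  assumes "(u, v) \<in> gcong" shows "realize u \<approx> realize v"
  using assms
proof induction
  case (rel u v)
  have root_words: "[p0] \<in> lists P" using root by simp
  from rel(1) consider (triv) e where "e \<in> tree_idempotents S T \<union> PD" "u = [(e, True)]" "v = []"
    | (star) e where "e \<in> E" "u = [(e, True)]" "v = [(e\<^sup>\<star>, False)]"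
    | (linked) e f g h where "linked_square S e f g h" "e \<in> D" "f \<in> D" "g \<in> D" "h \<in> D"
        "u = [(e, False), (f, True)]" "v = [(g, False), (h, True)]"
    | (cancel) e b where "e \<in> E" "u = [(e, b), (e, \<not> b)]" "v = []"
    by (auto simp: subgroup_relations_def free_cancellation_def)
  then show ?case
  proof cases
    case triv
    then show ?thesis
      using pg_append[OF loop_trivial[OF triv(1)] pg_refl[OF root_words]] pg_idem[OF root]
      by (auto intro: pg_trans)
  next
    case star
    then have "(e\<^sup>\<star>)\<^sup>\<star> = e" by (auto simp: idempotents_def star_star)
    \<comment> \<open>The inverse letter of \<open>e\<^sup>\<star>\<close> is realized by the loop
      of \<open>(e\<^sup>\<star>)\<^sup>\<star> = e\<close>, so both sides give the same
      word.\<close>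
    then have "realize v = realize u" using star by simp
    then show ?thesis using pg_refl[of "realize u"] realize_lists[OF rel(2)] by simp
  next
    case linked
    then show ?thesis
      using pg_append[OF loop_linked[OF linked(1-5)] pg_refl[OF root_words]] by simp
  next
    case cancel
    then have "(e\<^sup>\<star>)\<^sup>\<star> = e" by (auto simp: idempotents_def star_star)
    then have "loop (if b then e else e\<^sup>\<star>) @ loop (if \<not> b then e else e\<^sup>\<star>) \<approx> [p0]"
      using loop_star[OF cancel(1)] loop_star[OF E_projections(3)[OF cancel(1)]] by simp
    then show ?thesis
      using pg_append[OF _ pg_refl[OF root_words]] pg_idem[OF root] cancel
      by (fastforce intro: pg_trans)
  qed
next
  case (refl u)
  then show ?case using realize_lists[of u] by (intro pg_refl) auto
next
  case (append u v u' v')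
  have "u \<in> gwords" "v \<in> gwords" "u' \<in> gwords" "v' \<in> gwords"
    using append.hyps word_cong_subset[OF lists_append_closed] by blast+
  then show ?case
    using pg_trans[OF realize_append pg_trans[OF pg_append[OF append.IH] pg_sym[OF realize_append]]]
    by blast
qed (auto intro: pg_sym pg_trans)

lemma realize_act:
  assumes "w \<in> gwords" "g \<in> carrier G"
  shows "act (realize w) (p0, g) = Some (p0, g \<otimes>\<^bsub>G\<^esub> gcong `` {w})"
  using assms
proof (induction w arbitrary: g rule: list.induct)
  case Nil
  then show ?case using act_self[OF root_PD] G.r_one by (simp add: one_group_presentation[symmetric])
next
  case (Cons x w)
  obtain e b where x: "x = (e, b)" by force
  have e: "e \<in> E" and w: "w \<in> gwords" using Cons.prems by (auto simp: x)
  define e' where "e' = (if b then e else e\<^sup>\<star>)"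
  have e': "e' \<in> E" unfolding e'_def using e E_projections(3)[OF e] by auto
  have gen: "gen e' = gcong `` {[(e, b)]}"
    unfolding e'_def
    using inv_presentation_generator[OF e] gen_star[OF e] by (simp add: presentation_generator_def)
  have "gen e' \<otimes>\<^bsub>G\<^esub> gcong `` {w} = gcong `` {x # w}"
    unfolding gen using e w by (simp add: x mult_group_presentation)
  moreover have "gcong `` {w} \<in> carrier G" using w by (auto simp: carrier_group_presentation)
  moreover have "realize (x # w) = loop e' @ realize w" by (simp add: x e'_def)
  ultimately show ?case
    using loop_act[OF e' Cons.prems(2)] Cons.IH[OF w] Cons.prems(2) gen_closed[OF e']
    by (simp add: act_append G.m_assoc del: realize.simps)
qed

text \<open>Acting on \<open>p0\<close> with the identity of \<open>G\<close>, the realized word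
  returns the group element it came from, by \<open>realize_act\<close>.\<close>

lemma realize_inject:
  assumes "u \<in> gwords" "v \<in> gwords" "realize u \<approx> realize v"
  shows "gcong `` {u} = gcong `` {v}"
proof -
  have "gcong `` {u} \<in> carrier G" "gcong `` {v} \<in> carrier G"
    using assms by (auto simp: carrier_group_presentation)
  then show ?thesis
    using act_cong[OF assms(3) root_PD G.one_closed]
    by (simp add: realize_act[OF assms(1)] realize_act[OF assms(2)])
qed

section \<open>Every element of the maximal subgroup is realized\<close>

text \<open>The first letter \<open>r\<close> is exchanged for the position \<open>p1\<close> it
  leads to, and a \<open>detour\<close> at \<open>p1\<close> splits off the loop of
  \<open>p \<cdot> p1\<close>; the rest is handled from \<open>p1\<close> by induction.\<close>

lemma act_realize:
  assumes "act w (p, g) = Some (q, h)" "w \<in> lists P" "p \<in> PD"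
  shows "\<exists>z \<in> gwords. path_word p0 p @ [p] @ w \<approx> realize z @ path_word p0 q"
  using assms
proof (induction w arbitrary: p g)
  case Nil
  then have q: "q = p" "p \<in> P" by auto
  have l: "path_word p0 p \<in> lists P" "path_word p0 p \<noteq> []"
    using path_word_lists[OF root_PD Nil.prems(3)] by auto
  have "path_word p0 p @ [p] \<approx> path_word p0 p @ path_word p p"
    using l by (intro pg_append pg_refl pg_sym[OF path_word_refl] Nil.prems) auto
  also have "\<dots> \<approx> path_word p0 p" by (intro path_word_append root_PD Nil.prems)
  also have "\<dots> \<approx> path_word p0 p0 @ path_word p0 p"
    by (intro pg_sym[OF path_word_append] root_PD Nil.prems)
  also have "\<dots> \<approx> [p0] @ path_word p0 p"
    using l by (intro pg_append pg_refl path_word_refl root_PD) auto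
  finally show ?case using q by (intro bexI[of _ "[]"]) auto
next
  case (Cons r w)
  define p1 where "p1 = r \<cdot> p \<cdot> r"
  have r: "p \<cdot> r \<cdot> p = p" "act w (p1, g \<otimes>\<^bsub>G\<^esub> gen (p \<cdot> r)) = Some (q, h)"
    using Cons.prems by (auto simp: step_def p1_def split: if_splits)
  have P: "r \<in> P" "w \<in> lists P" "p \<in> P" using Cons.prems by auto
  note c = step_closed[OF Cons.prems(3) P(1) r(1), folded p1_def]
  have e: "p \<cdot> p1 \<in> E" using friendly_D(3)[OF c(1)] Cons.prems(3) by auto
  obtain z where z: "z \<in> gwords" "path_word p0 p1 @ [p1] @ w \<approx> realize z @ path_word p0 q"
    using Cons.IH[OF r(2) P(2) c(2)] by blast
  have l: "path_word p0 p \<in> lists P"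
    using path_word_lists[OF root_PD Cons.prems(3)] by auto
  have "path_word p0 p @ [p, r] @ w \<approx> path_word p0 p @ [p, p1] @ w"
    unfolding p1_def using P by (intro pg_context l pg_mult_conj) auto
  also have "\<dots> \<approx> loop (p \<cdot> p1) @ (path_word p0 p1 @ [p1] @ w)"
    using pg_sym[OF detour[OF c(2), of "path_word p0 p @ [p]" w]] l P
    by (simp add: loop_friendly[OF c(1)])
  also have "\<dots> \<approx> loop (p \<cdot> p1) @ (realize z @ path_word p0 q)"
    using loop_lists[OF e] by (intro pg_append pg_refl z) auto
  finally show ?case
    using z(1) e by (intro bexI[of _ "(p \<cdot> p1, True) # z"]) auto
qed

text \<open>The hypotheses express in words that \<open>w\<close> is \<H>-related to
  \<open>[p0]\<close>. They make \<open>w\<close> act at \<open>p0\<close> and return there, so that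
  \<open>act_realize\<close> applies with tree walks from \<open>p0\<close> to itself.\<close>

lemma realize_surj:
  assumes w: "w \<in> lists P" and s: "s \<in> lists P" and t: "t \<in> lists P" and t': "t' \<in> lists P"
    and right: "w @ s \<approx> [p0]" and left: "t @ w \<approx> [p0]" "w \<approx> t' @ [p0]" and root_w: "[p0] @ w \<approx> w"
  shows "\<exists>z \<in> gwords. w \<approx> realize z"
proof -
  note one = G.one_closed
  \<comment> \<open>Since \<open>w @ s\<close> acts like \<open>[p0]\<close>, the action of its
    prefix \<open>w\<close> is defined.\<close>
  have "act (w @ s) (p0, \<one>\<^bsub>G\<^esub>) = Some (p0, \<one>\<^bsub>G\<^esub>)"
    using act_cong[OF right root_PD one] act_self[OF root_PD one] by simp
  then obtain q h where q: "act w (p0, \<one>\<^bsub>G\<^esub>) = Some (q, h)"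
    by (cases "act w (p0, \<one>\<^bsub>G\<^esub>)") (auto simp: act_append)
  \<comment> \<open>The image of \<open>w\<close> in \<open>S\<close>, multiplied by
    \<open>p0\<close>; by \<open>act_foldl\<close> the final position is
    \<open>m\<^sup>\<star> \<cdot> m\<close>.\<close>
  define m where "m = foldl (\<cdot>) p0 w"
  have p0: "p0 \<in> carrier S" "p0 \<cdot> p0 = p0" "p0\<^sup>\<star> = p0" using projD[OF root] by auto
  have m: "m \<in> carrier S" "m\<^sup>\<star> \<cdot> m = q"
    using act_foldl[OF q w p0(1)] foldl_mult_closed[OF p0(1) w] p0 by (auto simp: m_def)
  have "m = foldl (\<cdot>) p0 t' \<cdot> p0"
    using foldl_mult_cong[OF left(2) p0(1)] by (simp add: m_def)
  then have mp0: "m \<cdot> p0 = m"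
    using p0 foldl_mult_closed[OF p0(1) t'] by (simp add: mult_assoc)
  define b where "b = foldl (\<cdot>) p0 t"
  have b: "b \<in> carrier S" using foldl_mult_closed[OF p0(1) t] by (simp add: b_def)
  have "p0 = foldl (\<cdot>) b w"
    using foldl_mult_cong[OF left(1) p0(1)] p0 by (simp add: b_def)
  also have "\<dots> = foldl (\<cdot>) b ([p0] @ w)"
    using foldl_mult_cong[OF root_w b] by simp
  also have "\<dots> = b \<cdot> m"
    using foldl_mult_assoc[OF b p0(1) w] by (simp add: m_def)
  finally have p0_eq: "p0 = b \<cdot> m" .
  \<comment> \<open>From \<open>m \<cdot> p0 = m\<close> and \<open>p0 = b \<cdot> m\<close> the
    projections \<open>q\<close> and \<open>p0\<close> absorb each other, so the action ends at
    \<open>p0\<close>.\<close>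
  have "q \<cdot> p0 = q"
    using mp0 m p0 by (metis mult_assoc star_closed)
  moreover have "p0 \<cdot> q = p0"
    using p0_eq m b mult_star_mult[of m] by (metis mult_assoc mult_closed star_closed)
  moreover have "q \<in> P" using star_mult_self_proj m by blast
  ultimately have "q = p0" using proj_eq_of_absorb root by blast
  then obtain z where z: "z \<in> gwords" "path_word p0 p0 @ [p0] @ w \<approx> realize z @ path_word p0 p0"
    using act_realize[OF q w root_PD] by blast
  have p0w: "[p0] @ w \<in> lists P" using w root by simp
  have "w \<approx> [p0] @ w" by (rule pg_sym[OF root_w])
  also have "\<dots> \<approx> [p0] @ ([p0] @ w)"
    using pg_sym[OF pg_context[OF pg_idem[OF root], of "[]" w]] w by simp
  also have "\<dots> \<approx> path_word p0 p0 @ [p0] @ w"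
    using p0w by (intro pg_append pg_refl pg_sym[OF path_word_refl] root_PD) auto
  also have "\<dots> \<approx> realize z @ path_word p0 p0" by (rule z(2))
  also have "\<dots> \<approx> realize z @ [p0]"
    using realize_lists[OF z(1)] by (intro pg_append pg_refl path_word_refl root_PD) auto
  also have "\<dots> \<approx> realize z" by (rule realize_root[OF z(1)])
  finally show ?thesis using z(1) by blast
qed

text \<open>Here \<open>s\<close> may be empty, which covers the identity adjoined in
  \<open>right_ideal\<close>.\<close>

lemma green_R_PG_D:
  assumes "(pg_class u, pg_class v) \<in> green_R (PG P \<theta>)" "u \<in> lists P - {[]}" "v \<in> lists P - {[]}"
  shows "\<exists>s \<in> lists P. u \<approx> v @ s"
  using green_RD[OF assms(1)]
proof
  assume "pg_class u = pg_class v"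
  then show ?thesis using assms pg_class_eq_iff by (intro bexI[of _ "[]"]) auto
next
  assume "\<exists>x \<in> carrier (PG P \<theta>). pg_class u = pg_class v \<cdot>\<^bsub>PG P \<theta>\<^esub> x"
  then obtain s where "s \<in> lists P - {[]}" "pg_class u = pg_class (v @ s)"
    using assms(3) mult_PG by (auto simp: carrier_PG)
  then show ?thesis using assms pg_class_eq_iff[of u "v @ s"] by auto
qed

lemma green_L_PG_D:
  assumes "(pg_class u, pg_class v) \<in> green_L (PG P \<theta>)" "u \<in> lists P - {[]}" "v \<in> lists P - {[]}"
  shows "\<exists>s \<in> lists P. u \<approx> s @ v"
  using green_LD[OF assms(1)]
proof
  assume "pg_class u = pg_class v"
  then show ?thesis using assms pg_class_eq_iff by (intro bexI[of _ "[]"]) auto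
next
  assume "\<exists>x \<in> carrier (PG P \<theta>). pg_class u = x \<cdot>\<^bsub>PG P \<theta>\<^esub> pg_class v"
  then obtain s where "s \<in> lists P - {[]}" "pg_class u = pg_class (s @ v)"
    using assms(3) mult_PG by (auto simp: carrier_PG)
  then show ?thesis using assms pg_class_eq_iff[of u "s @ v"] by auto
qed

abbreviation H :: "'a list set monoid" where
  "H \<equiv> maximal_subgroup (PG P \<theta>) (pg_generator P \<theta> p0)"

text \<open>A word \<open>v\<close> for the inverse in \<open>G\<close> gives
  \<open>realize v\<close>, which multiplies \<open>realize u\<close> to \<open>[p0]\<close> on
  either side; as \<open>[p0]\<close> is a two-sided identity for \<open>realize u\<close>, both
  Green relations follow.\<close>

lemma realize_in_H:
  assumes u: "u \<in> gwords" shows "pg_class (realize u) \<in> carrier H"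
proof -
  have "gcong `` {u} \<in> carrier G" using u by (auto simp: carrier_group_presentation)
  then have "inv\<^bsub>G\<^esub> (gcong `` {u}) \<in> carrier G" and
    inv: "gcong `` {u} \<otimes>\<^bsub>G\<^esub> inv\<^bsub>G\<^esub> (gcong `` {u}) = \<one>\<^bsub>G\<^esub>"
      "inv\<^bsub>G\<^esub> (gcong `` {u}) \<otimes>\<^bsub>G\<^esub> gcong `` {u} = \<one>\<^bsub>G\<^esub>"
    by auto
  then obtain v where v: "v \<in> gwords" "inv\<^bsub>G\<^esub> (gcong `` {u}) = gcong `` {v}"
    by (auto simp: carrier_group_presentation)
  have "(u @ v, []) \<in> gcong" "(v @ u, []) \<in> gcong"
    using inv u v(1) unfolding v(2)
    by (simp_all add: mult_group_presentation one_group_presentation group_presentation_eq_iff)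
  from this[THEN realize_cong]
  have uv: "realize u @ realize v \<approx> [p0]" "realize v @ realize u \<approx> [p0]"
    using pg_trans[OF pg_sym[OF realize_append]] u v(1) by auto
  have w: "realize u \<in> lists P - {[]}" "realize v \<in> lists P - {[]}" "[p0] \<in> lists P - {[]}"
    using realize_lists u v root by auto
  note app = nonempty_lists_append_closed
  have car: "pg_class x \<in> carrier (PG P \<theta>)" if "x \<in> lists P - {[]}" for x
    using that by (auto simp: carrier_PG)
  have "(pg_class [p0], pg_class (realize u)) \<in> green_R (PG P \<theta>)"
    by (rule PG.green_RI[OF car[OF w(3)] car[OF w(1)] car[OF w(2)] car[OF w(1)]])
      (use w uv pg_sym[OF root_realize[OF u]] pg_sym[OF uv(1)] in
        \<open>simp_all add: mult_PG pg_class_eq_iff app del: append_Cons\<close>)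
  moreover have "(pg_class [p0], pg_class (realize u)) \<in> green_L (PG P \<theta>)"
    by (rule PG.green_LI[OF car[OF w(3)] car[OF w(1)] car[OF w(2)] car[OF w(1)]])
      (use w uv pg_sym[OF realize_root[OF u]] pg_sym[OF uv(2)] in
        \<open>simp_all add: mult_PG pg_class_eq_iff app\<close>)
  ultimately show ?thesis
    by (simp add: maximal_subgroup_def green_H_def pg_generator_class)
qed

lemma H_realize:
  assumes "B \<in> carrier H" shows "\<exists>z \<in> gwords. B = pg_class (realize z)"
proof -
  have B: "(pg_class [p0], B) \<in> green_R (PG P \<theta>)" "(pg_class [p0], B) \<in> green_L (PG P \<theta>)"
    using assms by (auto simp: maximal_subgroup_def green_H_def pg_generator_class)
  then obtain w where w: "w \<in> lists P - {[]}" "B = pg_class w"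
    by (auto simp: green_R_def carrier_PG)
  have r: "[p0] \<in> lists P - {[]}" using root by simp
  note B' = B[unfolded w(2)]
  obtain s where s: "s \<in> lists P" "[p0] \<approx> w @ s" using green_R_PG_D[OF B'(1) r w(1)] by blast
  obtain t where t: "t \<in> lists P" "[p0] \<approx> t @ w" using green_L_PG_D[OF B'(2) r w(1)] by blast
  obtain s' where s': "s' \<in> lists P" "w \<approx> [p0] @ s'"
    using green_R_PG_D[OF green_sym(1)[OF B'(1)] w(1) r] by blast
  obtain t' where t': "t' \<in> lists P" "w \<approx> t' @ [p0]"
    using green_L_PG_D[OF green_sym(2)[OF B'(2)] w(1) r] by blast
  \<comment> \<open>As \<open>w\<close> is congruent to a word starting with \<open>p0\<close>, the
    letter \<open>p0\<close> is a left identity for it.\<close>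
  have "[p0] @ w \<approx> [p0] @ ([p0] @ s')"
    using root by (intro pg_append pg_refl s') auto
  also have "\<dots> \<approx> [p0] @ s'"
    using pg_context[OF pg_idem[OF root], of "[]" s'] s' by simp
  also have "\<dots> \<approx> w" by (rule pg_sym[OF s'(2)])
  finally have "[p0] @ w \<approx> w" .
  then obtain z where "z \<in> gwords" "w \<approx> realize z"
    using realize_surj[OF _ s(1) t(1) t'(1) pg_sym[OF s(2)] pg_sym[OF t(2)] t'(2)] w by blast
  then show ?thesis
    using w pg_class_eq_iff[OF w(1) realize_lists] by auto
qed

lemma presentation_iso: "G \<cong> H"
proof -
  \<comment> \<open>The map is defined on whole classes, without choosing representatives: all words
    of a class have congruent realizations, so the saturation of their image is one class.\<close>
  define \<phi> where "\<phi> A = pg_cong `` (realize ` A)" for A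
  have \<phi>: "\<phi> (gcong `` {u}) = pg_class (realize u)" if u: "u \<in> gwords" for u
  proof -
    have "u \<in> gcong `` {u}" using u by (auto intro: word_cong.refl)
    moreover have "pg_class (realize v) = pg_class (realize u)" if "(u, v) \<in> gcong" for v
    proof -
      have "v \<in> gwords" using that word_cong_subset[OF lists_append_closed] by blast
      then show ?thesis
        using realize_cong[OF that] pg_class_eq_iff realize_lists u by metis
    qed
    ultimately show ?thesis unfolding \<phi>_def by blast
  qed
  have car: "carrier G = (\<lambda>w. gcong `` {w}) ` gwords" by (rule carrier_group_presentation)
  have "\<phi> \<in> iso G H"
  proof (rule isoI)
    show "\<phi> \<in> hom G H"
    proof (rule homI)
      fix A assume "A \<in> carrier G"
      then obtain u where u: "u \<in> gwords" "A = gcong `` {u}" by (auto simp: car)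
      show "\<phi> A \<in> carrier H" unfolding u(2) \<phi>[OF u(1)] by (rule realize_in_H[OF u(1)])
      fix B assume "B \<in> carrier G"
      then obtain v where v: "v \<in> gwords" "B = gcong `` {v}" by (auto simp: car)
      have "pg_class (realize (u @ v)) = pg_class (realize u @ realize v)"
        using pg_class_eq_iff[of "realize (u @ v)" "realize u @ realize v"] realize_append[OF u(1) v(1)]
          realize_lists[OF u(1)] realize_lists[OF v(1)] realize_lists[of "u @ v"] u v by auto
      then show "\<phi> (A \<otimes>\<^bsub>G\<^esub> B) = \<phi> A \<otimes>\<^bsub>H\<^esub> \<phi> B"
        using u v \<phi>[of "u @ v"] realize_lists[OF u(1)] realize_lists[OF v(1)]
        by (simp add: mult_group_presentation \<phi> maximal_subgroup_def mult_PG)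
    qed
    show "bij_betw \<phi> (carrier G) (carrier H)"
      unfolding bij_betw_def
    proof
      show "inj_on \<phi> (carrier G)"
      proof (rule inj_onI)
        fix A B assume "A \<in> carrier G" "B \<in> carrier G" and eq: "\<phi> A = \<phi> B"
        then obtain u v where uv: "u \<in> gwords" "v \<in> gwords" "A = gcong `` {u}" "B = gcong `` {v}"
          by (auto simp: car)
        then have "realize u \<approx> realize v"
          using eq pg_class_eq_iff realize_lists by (metis \<phi>)
        then show "A = B" using realize_inject uv by simp
      qed
      show "\<phi> ` carrier G = carrier H"
      proof
        show "\<phi> ` carrier G \<subseteq> carrier H"
        proof
          fix B assume "B \<in> \<phi> ` carrier G"
          then obtain u where u: "u \<in> gwords" "B = \<phi> (gcong `` {u})" unfolding car by blast
          show "B \<in> carrier H" unfolding u(2) \<phi>[OF u(1)] by (rule realize_in_H[OF u(1)])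
        qed
        show "carrier H \<subseteq> \<phi> ` carrier G"
        proof
          fix B assume "B \<in> carrier H"
          then obtain z where z: "z \<in> gwords" "B = pg_class (realize z)" using H_realize by blast
          have "gcong `` {z} \<in> carrier G" unfolding car by (rule imageI[OF z(1)])
          then show "B \<in> \<phi> ` carrier G" unfolding z(2) \<phi>[OF z(1), symmetric] by (rule imageI)
        qed
      qed
    qed
  qed
  then show ?thesis by (auto simp: is_iso_def)
qed

end

theorem corollary6p37:
  fixes S :: "('a, 'm) star_semigrp_scheme"
    and P :: "'a set" and \<theta> :: "'a \<Rightarrow> 'a \<Rightarrow> 'a"
    and p0 :: 'a and D :: "'a set" and T :: "'a pair_pre_digraph"
  assumes "regular_star_semigroup S"
    and "projection_generated S"
    and "P = projections S"
    and "\<And>p q. p \<in> P \<Longrightarrow> q \<in> P \<Longrightarrow> \<theta> p q = p \<cdot>\<^bsub>S\<^esub> q \<cdot>\<^bsub>S\<^esub> p"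
    and "p0 \<in> P"
    and "D = green_D S `` {p0}"
    and "rooted_spanning_tree p0 T (friendliness_digraph S D)"
  shows "group_presentation (idempotents S \<inter> D) (subgroup_relations S D T)
    \<cong> maximal_subgroup (PG P \<theta>) (pg_generator P \<theta> p0)"
proof -
  interpret regular_star_semigroup S by (rule assms(1))
  interpret rooted_projection_words S \<theta> p0 D T
    by unfold_locales (use assms(3-7) in auto)
  show ?thesis unfolding assms(3) by (rule presentation_iso)
qed

end
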